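(* For any fixed positive integer $r$, the following problem can be solved in polynomial time: given $n\geq r$, a graph $H$ on $[n]$, and functions $f_i:\{0,1,\dots,d_i(H)\}\to\mathbb{Z}$ for $i=1,\dots,n$, where $f_1,\dots,f_r$ are arbitrary and $f_{r+1},\dots,f_n$ are either all nondecreasing or all nonincreasing, find a subgraph $G\subseteq H$ on $[n]$ minimizing $\sum_{i=1}^n f_i(d_i(G))$.
   Context: All graphs are finite and simple, and $[n]:=\{1,\dots,n\}$. For a graph $G=([n],F)$ and $i\in[n]$, $d_i(G):=|\{e\in F: i\in e\}|$ is the degree of vertex $i$ in $G$. A subgraph $G\subseteq H$ on $[n]$ of a graph $H=([n],E)$ is a graph $G=([n],F)$ with $F\subseteq E$ (an arbitrary subset of the edges, on the full vertex set). Each function $f_i$ in the input is given by the explicit list of its values (integers in binary), and polynomial time means polynomial in the total bit size of the input, where the degree of the polynomial may depend on the constant $r$. *)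

theory Defs
  imports "HOL-Computational_Algebra.Polynomial" "HOL-Library.Log_Nat"
begin

section \<open>Polynomial time on a random access machine with logarithmic cost\<close>

text \<open>
  The machine is the random access machine of Cook--Reckhow and Aho--Hopcroft--Ullman, programmed
  with structured control flow instead of jumps. It has integer registers, of which a program
  mentions finitely many, and a memory of integer cells that is addressed indirectly through
  registers. Every instruction is charged the bit lengths of the integers it handles, addresses
  included (logarithmic cost criterion). The only arithmetic operations are addition and
  subtraction. Up to a polynomial, this running time is that of a Turing machine.
\<close>

datatype com =
    Skip
  | Const nat int
  | Add nat nat nat
  | Sub nat nat nat
  | Load nat nat
  | Store nat nat
  | Seq com com
  | IfPos nat com com
  | WhilePos nat com

type_synonym state = "(nat \<Rightarrow> int) \<times> (int \<Rightarrow> int)"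

text \<open>Length of the binary representation, with one further bit for the sign; so the size of 0 is 1.\<close>

definition bit_size :: "int \<Rightarrow> nat" where
  "bit_size k = Suc (floorlog 2 (nat \<bar>k\<bar>))"

text \<open>
  \<open>exec c s t s'\<close>: started in state \<open>s\<close>, the program \<open>c\<close> halts in state \<open>s'\<close> after time \<open>t\<close>.
  Register names are part of the program, so reading them costs only a constant factor, which is
  left out. \<open>Load x y\<close> is \<open>x := M[y]\<close> and \<open>Store x y\<close> is \<open>M[x] := y\<close>; \<open>IfPos\<close> and
  \<open>WhilePos\<close> test whether the register is positive.
\<close>

inductive exec :: "com \<Rightarrow> state \<Rightarrow> nat \<Rightarrow> state \<Rightarrow> bool" where
  Skip: "exec Skip s 1 s"
| Const: "exec (Const x k) (R, M) (bit_size k) (R(x := k), M)"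
| Add: "exec (Add x y z) (R, M) (bit_size (R y) + bit_size (R z)) (R(x := R y + R z), M)"
| Sub: "exec (Sub x y z) (R, M) (bit_size (R y) + bit_size (R z)) (R(x := R y - R z), M)"
| Load: "exec (Load x y) (R, M) (bit_size (R y) + bit_size (M (R y))) (R(x := M (R y)), M)"
| Store: "exec (Store x y) (R, M) (bit_size (R x) + bit_size (R y)) (R, M(R x := R y))"
| Seq: "\<lbrakk>exec c1 s t1 s'; exec c2 s' t2 s''\<rbrakk> \<Longrightarrow> exec (Seq c1 c2) s (t1 + t2) s''"
| IfTrue: "\<lbrakk>0 < R x; exec c1 (R, M) t s'\<rbrakk>
    \<Longrightarrow> exec (IfPos x c1 c2) (R, M) (bit_size (R x) + t) s'"
| IfFalse: "\<lbrakk>\<not> 0 < R x; exec c2 (R, M) t s'\<rbrakk>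
    \<Longrightarrow> exec (IfPos x c1 c2) (R, M) (bit_size (R x) + t) s'"
| WhileFalse: "\<not> 0 < R x \<Longrightarrow> exec (WhilePos x c) (R, M) (bit_size (R x)) (R, M)"
| WhileTrue: "\<lbrakk>0 < R x; exec c (R, M) t1 s'; exec (WhilePos x c) s' t2 s''\<rbrakk>
    \<Longrightarrow> exec (WhilePos x c) (R, M) (bit_size (R x) + t1 + t2) s''"

text \<open>
  A list of integers is stored in the memory with its length in cell 0 and its entries in the
  cells from 1 on; input and output both use this format.
\<close>

definition initial :: "int list \<Rightarrow> state" where
  "initial xs = ((\<lambda>_. 0),
     (\<lambda>a. if a = 0 then int (length xs)
          else if 1 \<le> a \<and> a \<le> int (length xs) then xs ! nat (a - 1) else 0))"

definition result :: "state \<Rightarrow> int list" where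
  "result s = map (snd s) [1..snd s 0]"

definition input_size :: "int list \<Rightarrow> nat" where
  "input_size xs = (\<Sum>x\<leftarrow>xs. bit_size x)"

text \<open>
  A search problem has a set \<open>I\<close> of instances and a relation \<open>sol\<close> between instances and their
  solutions; \<open>enc_in\<close> and \<open>enc_out\<close> write instances and solutions as lists of integers, where
  \<open>enc_out\<close> may refer to the instance. One program has to solve all instances, each within time
  polynomial in the bit size of its encoding.
\<close>

definition solvable_in_polynomial_time ::
  "'a set \<Rightarrow> ('a \<Rightarrow> int list) \<Rightarrow> ('a \<Rightarrow> 'b \<Rightarrow> bool) \<Rightarrow> ('a \<Rightarrow> 'b \<Rightarrow> int list) \<Rightarrow> bool" where
  "solvable_in_polynomial_time I enc_in sol enc_out \<longleftrightarrow>
     (\<exists>(c :: com) (p :: nat poly). \<forall>x\<in>I. \<exists>t s y.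
        exec c (initial (enc_in x)) t s \<and> t \<le> poly p (input_size (enc_in x)) \<and>
        sol x y \<and> result s = enc_out x y)"

lemma exec_deterministic:
  "exec c s t s' \<Longrightarrow> exec c s u s'' \<Longrightarrow> u = t \<and> s'' = s'"
proof (induction arbitrary: u s'' rule: exec.induct)
  case Skip
  from Skip.prems show ?case by cases simp_all
next
  case Const
  from Const.prems show ?case by cases simp_all
next
  case Add
  from Add.prems show ?case by cases simp_all
next
  case Sub
  from Sub.prems show ?case by cases simp_all
next
  case Load
  from Load.prems show ?case by cases simp_all
next
  case Store
  from Store.prems show ?case by cases simp_all
next
  case (Seq c1 s t1 s1 c2 t2 s2)
  from Seq.prems show ?case by cases (use Seq.IH in blast)
next
  case (IfTrue R x c1 M t s' c2)
  from IfTrue.prems show ?case 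
  proof cases
    case (IfTrue v)
    then show ?thesis using IfTrue.IH by blast
  next
    case (IfFalse v)
    then show ?thesis using IfTrue.hyps by simp
  qed
next
  case (IfFalse R x c2 M t s' c1)
  from IfFalse.prems show ?case 
  proof cases
    case (IfTrue v)
    then show ?thesis using IfFalse.hyps by simp
  next
    case (IfFalse v)
    then show ?thesis using IfFalse.IH by blast
  qed
next
  case (WhileFalse R x c M)
  from WhileFalse.prems show ?case by cases (use WhileFalse.hyps in simp_all)
next
  case (WhileTrue R x c M t1 s1 t2 s2)
  from WhileTrue.prems show ?case
  proof cases
    case WhileFalse
    then show ?thesis using WhileTrue.hyps by simp
  next
    case (WhileTrue v1 s3 v2)
    then show ?thesis using WhileTrue.IH by blast
  qed
qed

lemma result_initial [simp]: "result (initial xs) = xs"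
  by (rule nth_equalityI) (auto simp: result_def initial_def nth_upto)


section \<open>Graphs on \<open>{1..n}\<close>\<close>

definition simple_graph :: "nat \<Rightarrow> nat set set \<Rightarrow> bool" where
  "simple_graph n E \<longleftrightarrow> (\<forall>e\<in>E. e \<subseteq> {1..n} \<and> card e = 2)"

definition degree_in :: "nat set set \<Rightarrow> nat \<Rightarrow> nat" where
  "degree_in F i = card {e \<in> F. i \<in> e}"

text \<open>The adjacency matrix, row by row.\<close>

definition adjacency :: "nat \<Rightarrow> nat set set \<Rightarrow> int list" where
  "adjacency n F = concat (map (\<lambda>i. map (\<lambda>j. if {i, j} \<in> F then 1 else 0) [1..<Suc n]) [1..<Suc n])"

type_synonym instance_data = "nat \<times> nat set set \<times> (nat \<Rightarrow> nat \<Rightarrow> int)"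

text \<open>
  Only the values \<open>f i 0, \<dots>, f i (degree_in E i)\<close> with \<open>i \<in> {1..n}\<close> are part of the input; the
  values of the total function \<open>f\<close> elsewhere are irrelevant.
\<close>

definition encode_instance :: "instance_data \<Rightarrow> int list" where
  "encode_instance = (\<lambda>(n, E, f).
     int n # adjacency n E @
     concat (map (\<lambda>i. map (f i) [0..<Suc (degree_in E i)]) [1..<Suc n]))"

definition instances :: "nat \<Rightarrow> instance_data set" where
  "instances r = {(n, E, f). r \<le> n \<and> simple_graph n E \<and>
     ((\<forall>i\<in>{r+1..n}. mono_on {0..degree_in E i} (f i)) \<or>
      (\<forall>i\<in>{r+1..n}. antimono_on {0..degree_in E i} (f i)))}"

definition optimal_subgraph :: "instance_data \<Rightarrow> nat set set \<Rightarrow> bool" where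
  "optimal_subgraph = (\<lambda>(n, E, f).
     is_arg_min (\<lambda>F. \<Sum>i=1..n. f i (degree_in F i)) (\<lambda>F. F \<subseteq> E))"

text \<open>The output determines the subgraph.\<close>

lemma adjacency_inject:
  assumes F: "simple_graph n F" and F': "simple_graph n F'"
    and eq: "adjacency n F = adjacency n F'"
  shows "F = F'"
proof -
  let ?row = "\<lambda>F i. map (\<lambda>j. if {i, j} \<in> F then 1 else (0::int)) [1..<Suc n]"
  have "map (?row F) [1..<Suc n] = map (?row F') [1..<Suc n]"
    using eq unfolding adjacency_def
    by (rule concat_injective) (auto simp: set_zip simp del: upt_Suc)
  then have iff: "{i, j} \<in> F \<longleftrightarrow> {i, j} \<in> F'" if "i \<in> {1..n}" "j \<in> {1..n}" for i j
  proof -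
    have "?row F i = ?row F' i" "i \<in> set [1..<Suc n]" "j \<in> set [1..<Suc n]"
      using that \<open>map (?row F) _ = _\<close> by (auto simp: less_Suc_eq_le simp del: upt_Suc)
    then have "(if {i, j} \<in> F then 1 else (0::int)) = (if {i, j} \<in> F' then 1 else 0)"
      unfolding map_eq_conv by blast
    then show ?thesis
      by (simp split: if_splits)
  qed
  have "e \<in> F \<longleftrightarrow> e \<in> F'" if "e \<subseteq> {1..n}" "card e = 2" for e
    using that iff by (auto simp: card_2_iff)
  then show ?thesis
    using F F' unfolding simple_graph_def by blast
qed

end

theory Submission
  imports Defs "HOL-Library.Countable"
begin

text \<open>
  Write \<open>R\<close> for the first \<open>r\<close> vertices, whose functions are arbitrary, and \<open>S\<close> for the others.
  If the functions on \<open>S\<close> are nondecreasing, deleting from \<open>G\<close> all edges inside \<open>S\<close> changes no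
  degree in \<open>R\<close> and raises no value; if they are nonincreasing, the same holds for adding all edges
  of \<open>H\<close> inside \<open>S\<close>. So some optimal subgraph contains either no or every edge of \<open>H\<close> inside
  \<open>S\<close>. Both kinds of subgraph are feasible whatever the functions are; hence the algorithm
  minimizes over each kind (its \<^emph>\<open>mode\<close>) and keeps the better one, without testing which case of
  the hypothesis holds (\<open>opt_le_any\<close>).

  Once the mode is fixed, only edges that meet \<open>R\<close> are left to choose. Assign each of them to its
  larger endpoint: vertex \<open>i\<close> then chooses a set of earlier neighbours in \<open>R\<close>, one of at most
  \<open>2 ^ r\<close> sets. The degree of a vertex of \<open>S\<close> depends on its own choice alone, and indeed only on
  the size of the chosen set. What the past choices mean for the future is therefore summarized by
  the degrees that the vertices of \<open>R\<close> have collected so far, that is, by one of \<open>n ^ r\<close> vectors.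
  This gives a dynamic program over the vertices (\<open>opt\<close>) with \<open>n + 1\<close> layers of \<open>n ^ r\<close> entries; a
  vector is stored as the number with these digits in base \<open>n\<close>, so that a choice adds a constant to
  the index. The best choices are then read off by running through the layers once more
  (\<open>opt_greedy\<close>).

  The running time is obtained almost without computation. The algorithm is written in a language
  whose only loops are executed exactly \<open>n\<close> times, where \<open>n\<close> sits in a register that is never
  assigned, so the number of instructions is bounded by a polynomial in \<open>n\<close> that can be read off the
  program text (\<open>steps\<close>). Since the machine only adds and subtracts, each instruction lengthens the
  numbers in use by at most one bit. Hence every instruction costs at most linearly many bits in the
  input size plus the number of instructions, and polynomially many instructions take polynomial
  time (\<open>solvable_by_loop_program\<close>).

  Vertices are numbered from 0 in the program and from 1 in the problem.
\<close>

section \<open>A loop language\<close>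

text \<open>
  Registers have names here, so that distinct registers are distinct by the datatype. \<open>Size\<close> holds
  the number \<open>n\<close> of vertices. The indexed families are used at finitely many indices only:
  \<open>Power j\<close> holds \<open>n ^ j\<close>, \<open>Digit j\<close> the digit of the current state that belongs to vertex \<open>j\<close>,
  and \<open>Chosen j\<close> tells whether \<open>j\<close> belongs to the best choice found.
\<close>

datatype var =
    Size | Mode | Vertex | Row | FunPtr | Base | Ptr | Weight
  | Legal | Shift | Val | Best | BestShift | Acc | Pos | LayerSize | Out
  | Val0 | Val1 | Loop0 | Loop1 | Loop2 | Loop3
  | Power nat | Digit nat | Chosen nat

instance var :: countable
  by countable_datatype

datatype expr =
    Var var
  | Num int
  | Plus expr expr (infixl "[+]" 65)
  | Minus expr expr (infixl "[-]" 65)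
  | Mem expr

datatype prog =
    Pass
  | Assign var expr (infix "::=" 62)
  | Write expr expr
  | Then prog prog (infixr ";;" 60)
  | Cond expr prog prog
  | For var prog

type_synonym store = "(var \<Rightarrow> int) \<times> (int \<Rightarrow> int)"

primrec eval :: "expr \<Rightarrow> store \<Rightarrow> int" where
  "eval (Var x) s = fst s x"
| "eval (Num k) s = k"
| "eval (Plus a b) s = eval a s + eval b s"
| "eval (Minus a b) s = eval a s - eval b s"
| "eval (Mem a) s = snd s (eval a s)"

definition set_var :: "var \<Rightarrow> int \<Rightarrow> store \<Rightarrow> store" where
  "set_var x k s = ((fst s)(x := k), snd s)"

text \<open>
  The loop \<open>For x c\<close> runs its body for \<open>x = 0, \<dots>, n - 1\<close>. Therefore every program terminates and its
  meaning is a function on stores.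
\<close>

primrec den :: "prog \<Rightarrow> store \<Rightarrow> store" where
  "den Pass s = s"
| "den (x ::= e) s = set_var x (eval e s) s"
| "den (Write a e) s = (fst s, (snd s)(eval a s := eval e s))"
| "den (c ;; d) s = den d (den c s)"
| "den (Cond e c d) s = (if 0 < eval e s then den c s else den d s)"
| "den (For x c) s =
    ((\<lambda>s. set_var x (fst s x + 1) (den c s)) ^^ nat (fst s Size)) (set_var x 0 s)"

primrec written :: "prog \<Rightarrow> var set" where
  "written Pass = {}"
| "written (x ::= e) = {x}"
| "written (Write a e) = {}"
| "written (c ;; d) = written c \<union> written d"
| "written (Cond e c d) = written c \<union> written d"
| "written (For x c) = insert x (written c)"

text \<open>
  The number of iterations is known in advance if the body changes neither the counter nor the
  bound.
\<close>

primrec well_formed :: "prog \<Rightarrow> bool" where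
  "well_formed Pass = True"
| "well_formed (x ::= e) = True"
| "well_formed (Write a e) = True"
| "well_formed (c ;; d) = (well_formed c \<and> well_formed d)"
| "well_formed (Cond e c d) = (well_formed c \<and> well_formed d)"
| "well_formed (For x c) = (well_formed c \<and> x \<notin> written c \<and> Size \<notin> written c \<and> x \<noteq> Size)"

section \<open>Instruction counts and logarithmic cost\<close>

definition bounded :: "nat \<Rightarrow> state \<Rightarrow> bool" where
  "bounded b s \<longleftrightarrow> (\<forall>x. \<bar>fst s x\<bar> \<le> 2 ^ b) \<and> (\<forall>a. \<bar>snd s a\<bar> \<le> 2 ^ b)"

text \<open>
  An execution with \<open>k\<close> instructions, up to constants. As an addition at most doubles the largest
  number, \<open>b\<close> bits before the execution become at most \<open>b + k\<close> bits after it, and each instruction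
  handles at most two such numbers. The bound holds for all \<open>b\<close> at once and is therefore preserved
  by composition. A constant counts as many instructions as it has bits, because it may be longer
  than all other numbers.
\<close>

definition reaches :: "com \<Rightarrow> state \<Rightarrow> nat \<Rightarrow> state \<Rightarrow> bool" where
  "reaches c s k s' \<longleftrightarrow>
     (\<exists>t. exec c s t s' \<and> (\<forall>b. bounded b s \<longrightarrow> bounded (b + k) s' \<and> t \<le> k * (2 * (b + k) + 4)))"

lemma bit_size_le:
  assumes "\<bar>k\<bar> \<le> 2 ^ b"
  shows "bit_size k \<le> b + 2"
proof -
  have "nat \<bar>k\<bar> \<le> 2 ^ b"
    using assms by (simp add: nat_le_iff)
  then have "floorlog 2 (nat \<bar>k\<bar>) \<le> floorlog 2 (2 ^ b)"
    by (rule floorlog_mono)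
  also have "\<dots> = Suc b"
    by (simp add: floorlog_def log_nat_power)
  finally show ?thesis
    by (simp add: bit_size_def)
qed

lemma less_power_bit_size: "\<bar>k\<bar> < 2 ^ bit_size k"
proof -
  have "nat \<bar>k\<bar> < 2 ^ floorlog 2 (nat \<bar>k\<bar>)"
    using floorlog_bounds[of "nat \<bar>k\<bar>" 2] by (cases "nat \<bar>k\<bar> = 0") auto
  also have "\<dots> \<le> 2 ^ bit_size k"
    by (rule power_increasing) (auto simp: bit_size_def)
  finally have "int (nat \<bar>k\<bar>) < int (2 ^ bit_size k)"
    by (simp only: of_nat_less_iff)
  then show ?thesis by simp
qed

lemma bounded_mono:
  assumes "bounded b s" "b \<le> b'"
  shows "bounded b' s"
proof -
  have "(2::int) ^ b \<le> 2 ^ b'"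
    using assms(2) by (rule power_increasing) simp
  then show ?thesis
    using assms(1) unfolding bounded_def by (meson order_trans)
qed

lemma reaches_mono:
  assumes "reaches c s k s'" "k \<le> k'"
  shows "reaches c s k' s'"
proof -
  obtain t where t: "exec c s t s'"
    "\<And>b. bounded b s \<Longrightarrow> bounded (b + k) s' \<and> t \<le> k * (2 * (b + k) + 4)"
    using assms(1) unfolding reaches_def by blast
  have "bounded (b + k') s' \<and> t \<le> k' * (2 * (b + k') + 4)" if "bounded b s" for b
  proof -
    have "k * (2 * (b + k) + 4) \<le> k' * (2 * (b + k') + 4)"
      using assms(2) by (intro mult_le_mono) auto
    then show ?thesis
      using t(2)[OF that] bounded_mono[of "b + k" s' "b + k'"] assms(2) by auto
  qed
  then show ?thesis
    using t(1) unfolding reaches_def by blast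
qed

lemma reaches_Seq:
  assumes "reaches c s k s'" "reaches d s' l s''"
  shows "reaches (Seq c d) s (k + l) s''"
proof -
  obtain t where t: "exec c s t s'"
    "\<And>b. bounded b s \<Longrightarrow> bounded (b + k) s' \<and> t \<le> k * (2 * (b + k) + 4)"
    using assms(1) unfolding reaches_def by blast
  obtain u where u: "exec d s' u s''"
    "\<And>b. bounded b s' \<Longrightarrow> bounded (b + l) s'' \<and> u \<le> l * (2 * (b + l) + 4)"
    using assms(2) unfolding reaches_def by blast
  have "bounded (b + (k + l)) s'' \<and> t + u \<le> (k + l) * (2 * (b + (k + l)) + 4)" if "bounded b s" for b
  proof -
    have "t \<le> k * (2 * (b + (k + l)) + 4)"
      using t(2)[OF that] by (rule conjE) (erule order_trans, rule mult_le_mono, auto)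
    moreover have "u \<le> l * (2 * (b + (k + l)) + 4)"
      using u(2)[of "b + k"] t(2)[OF that] by (simp add: add.assoc)
    ultimately show ?thesis
      using u(2)[of "b + k"] t(2)[OF that] by (auto simp: add.assoc add_mult_distrib)
  qed
  then show ?thesis
    using exec.Seq[OF t(1) u(1)] unfolding reaches_def by blast
qed

lemma bounded_upd_reg:
  "bounded b (R, M) \<Longrightarrow> \<bar>k\<bar> \<le> 2 ^ b \<Longrightarrow> bounded b (R(x := k), M)"
  by (auto simp: bounded_def)

lemma reaches_Skip: "reaches Skip s 1 s"
  unfolding reaches_def
  using exec.Skip by (intro exI[of _ 1]) (auto intro: bounded_mono)

lemma reaches_Const: "reaches (Const x k) (R, M) (bit_size k) (R(x := k), M)"
proof -
  have "bounded (b + bit_size k) (R(x := k), M)" if "bounded b (R, M)" for b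
  proof (rule bounded_upd_reg)
    show "bounded (b + bit_size k) (R, M)"
      using that by (rule bounded_mono) simp
    have "(2::int) ^ bit_size k \<le> 2 ^ (b + bit_size k)"
      by (rule power_increasing) auto
    then show "\<bar>k\<bar> \<le> 2 ^ (b + bit_size k)"
      using less_power_bit_size[of k] by linarith
  qed
  then show ?thesis
    unfolding reaches_def using exec.Const by (intro exI[of _ "bit_size k"]) auto
qed

lemma reaches_arith:
  assumes "k = R y + R z \<and> c = Add x y z \<or> k = R y - R z \<and> c = Sub x y z"
  shows "reaches c (R, M) 1 (R(x := k), M)"
proof -
  have "bounded (b + 1) (R(x := k), M) \<and> bit_size (R y) + bit_size (R z) \<le> 1 * (2 * (b + 1) + 4)"
    if "bounded b (R, M)" for b
  proof -
    have yz: "\<bar>R y\<bar> \<le> 2 ^ b" "\<bar>R z\<bar> \<le> 2 ^ b"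
      using that by (auto simp: bounded_def)
    then have "\<bar>k\<bar> \<le> 2 ^ (b + 1)"
      using assms by auto
    then show ?thesis
      using bounded_mono[OF that, of "b + 1"] bounded_upd_reg bit_size_le[OF yz(1)]
        bit_size_le[OF yz(2)] by simp
  qed
  then show ?thesis
    unfolding reaches_def using assms exec.Add exec.Sub
    by (intro exI[of _ "bit_size (R y) + bit_size (R z)"]) fastforce
qed

lemma reaches_Add: "reaches (Add x y z) (R, M) 1 (R(x := R y + R z), M)"
  and reaches_Sub: "reaches (Sub x y z) (R, M) 1 (R(x := R y - R z), M)"
  by (rule reaches_arith; simp)+

lemma reaches_Load: "reaches (Load x y) (R, M) 1 (R(x := M (R y)), M)"
proof -
  have "bounded (b + 1) (R(x := M (R y)), M) \<and>
      bit_size (R y) + bit_size (M (R y)) \<le> 1 * (2 * (b + 1) + 4)"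
    if "bounded b (R, M)" for b
  proof -
    have yz: "\<bar>R y\<bar> \<le> 2 ^ b" "\<bar>M (R y)\<bar> \<le> 2 ^ b"
      using that by (auto simp: bounded_def)
    then have "bounded b (R(x := M (R y)), M)"
      using that bounded_upd_reg by blast
    then have "bounded (b + 1) (R(x := M (R y)), M)"
      by (rule bounded_mono) simp
    then show ?thesis
      using bit_size_le[OF yz(1)] bit_size_le[OF yz(2)] by simp
  qed
  then show ?thesis
    unfolding reaches_def using exec.Load by blast
qed

lemma reaches_Store: "reaches (Store x y) (R, M) 1 (R, M(R x := R y))"
proof -
  have "bounded (b + 1) (R, M(R x := R y)) \<and>
      bit_size (R x) + bit_size (R y) \<le> 1 * (2 * (b + 1) + 4)"
    if "bounded b (R, M)" for b
  proof -
    have yz: "\<bar>R x\<bar> \<le> 2 ^ b" "\<bar>R y\<bar> \<le> 2 ^ b"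
      using that by (auto simp: bounded_def)
    then have "bounded b (R, M(R x := R y))"
      using that by (auto simp: bounded_def)
    then have "bounded (b + 1) (R, M(R x := R y))"
      by (rule bounded_mono) simp
    then show ?thesis
      using bit_size_le[OF yz(1)] bit_size_le[OF yz(2)] by simp
  qed
  then show ?thesis
    unfolding reaches_def using exec.Store by blast
qed

text \<open>
  Shared by the conditional and by an iteration of the while loop: testing a register costs one
  instruction on top of the code that is then run.
\<close>

lemma reaches_test:
  assumes "reaches c s k s'"
    and "\<And>t. exec c s t s' \<Longrightarrow> exec d s (bit_size (fst s x) + t) s'"
  shows "reaches d s (k + 1) s'"
proof -
  obtain t where t: "exec c s t s'"
    "\<And>b. bounded b s \<Longrightarrow> bounded (b + k) s' \<and> t \<le> k * (2 * (b + k) + 4)"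
    using assms(1) unfolding reaches_def by blast
  have "bounded (b + (k + 1)) s' \<and> bit_size (fst s x) + t \<le> (k + 1) * (2 * (b + (k + 1)) + 4)"
    if "bounded b s" for b
  proof -
    have "t \<le> k * (2 * (b + (k + 1)) + 4)"
      using t(2)[OF that] by (rule conjE) (erule order_trans, rule mult_le_mono, auto)
    moreover have "bit_size (fst s x) \<le> b + 2"
      using that by (intro bit_size_le) (auto simp: bounded_def)
    moreover have "bounded (b + (k + 1)) s'"
      using t(2)[OF that] by (auto intro: bounded_mono)
    ultimately show ?thesis
      by simp
  qed
  then show ?thesis
    unfolding reaches_def using assms(2)[OF t(1)] by blast
qed

lemma reaches_IfPos:
  assumes "reaches (if 0 < R x then c else d) (R, M) k s'"
  shows "reaches (IfPos x c d) (R, M) (k + 1) s'"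
  using assms by (rule reaches_test[where x = x]) (auto intro: exec.IfTrue exec.IfFalse split: if_splits)

lemma reaches_While_stop:
  assumes "\<not> 0 < R x"
  shows "reaches (WhilePos x c) (R, M) 1 (R, M)"
proof -
  have "bounded (b + 1) (R, M) \<and> bit_size (R x) \<le> 1 * (2 * (b + 1) + 4)" if "bounded b (R, M)" for b
  proof -
    have "bit_size (R x) \<le> b + 2"
      using that by (intro bit_size_le) (auto simp: bounded_def)
    moreover have "bounded (b + 1) (R, M)"
      using that by (rule bounded_mono) simp
    ultimately show ?thesis by simp
  qed
  then show ?thesis
    unfolding reaches_def using exec.WhileFalse[of R x, OF assms] by blast
qed

lemma reaches_While_step:
  assumes "0 < R x" "reaches c (R, M) k s'" "reaches (WhilePos x c) s' l s''"
  shows "reaches (WhilePos x c) (R, M) (k + l + 1) s''"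
proof (rule reaches_test[where x = x])
  show "reaches (Seq c (WhilePos x c)) (R, M) (k + l) s''"
    using assms(2,3) by (rule reaches_Seq)
  show "exec (WhilePos x c) (R, M) (bit_size (fst (R, M) x) + t) s''"
    if "exec (Seq c (WhilePos x c)) (R, M) t s''" for t
    using that by cases (use exec.WhileTrue[where R = R and x = x] assms(1) in \<open>fastforce simp: add.assoc\<close>)
qed

section \<open>Compilation to the random access machine\<close>

text \<open>
  Even machine registers hold the named registers, odd ones are temporary. An expression is
  evaluated into \<open>tmp k\<close> like on a stack, leaving the lower temporaries intact.
\<close>

definition reg :: "var \<Rightarrow> nat" where "reg x = 2 * to_nat x"

definition tmp :: "nat \<Rightarrow> nat" where "tmp k = 2 * k + 1"

lemma reg_eq_iff [simp]: "reg x = reg y \<longleftrightarrow> x = y"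
  by (simp add: reg_def)

lemma tmp_eq_iff [simp]: "tmp j = tmp k \<longleftrightarrow> j = k"
  by (simp add: tmp_def)

lemma reg_neq_tmp [simp]: "reg x \<noteq> tmp k" "tmp k \<noteq> reg x"
  by (simp_all add: reg_def tmp_def) presburger+

primrec compile_expr :: "nat \<Rightarrow> expr \<Rightarrow> com" where
  "compile_expr k (Var x) = Seq (Const (tmp k) 0) (Add (tmp k) (reg x) (tmp k))"
| "compile_expr k (Num i) = Const (tmp k) i"
| "compile_expr k (Plus a b) =
    Seq (compile_expr k a) (Seq (compile_expr (Suc k) b) (Add (tmp k) (tmp k) (tmp (Suc k))))"
| "compile_expr k (Minus a b) =
    Seq (compile_expr k a) (Seq (compile_expr (Suc k) b) (Sub (tmp k) (tmp k) (tmp (Suc k))))"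
| "compile_expr k (Mem a) = Seq (compile_expr k a) (Load (tmp k) (tmp k))"

primrec expr_steps :: "expr \<Rightarrow> nat" where
  "expr_steps (Var x) = bit_size 0 + 1"
| "expr_steps (Num i) = bit_size i"
| "expr_steps (Plus a b) = expr_steps a + (expr_steps b + 1)"
| "expr_steps (Minus a b) = expr_steps a + (expr_steps b + 1)"
| "expr_steps (Mem a) = expr_steps a + 1"

definition represents :: "(nat \<Rightarrow> int) \<Rightarrow> (var \<Rightarrow> int) \<Rightarrow> bool" where
  "represents R S \<longleftrightarrow> (\<forall>x. R (reg x) = S x)"

lemma compile_expr_correct:
  assumes "represents R S"
  shows "\<exists>R'. reaches (compile_expr k e) (R, M) (expr_steps e) (R', M) \<and> represents R' S \<and>
    R' (tmp k) = eval e (S, M) \<and> (\<forall>j<k. R' (tmp j) = R (tmp j))"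
  using assms
proof (induction e arbitrary: k R)
  case (Var x)
  show ?case
    using reaches_Seq[OF reaches_Const[of "tmp k" 0 R M] reaches_Add[of "tmp k" "reg x" "tmp k"]] Var
    by (auto simp: represents_def)
next
  case (Num i)
  show ?case
    using reaches_Const[of "tmp k" i R M] Num by (auto simp: represents_def)
next
  case (Plus a b)
  obtain R1 where R1: "reaches (compile_expr k a) (R, M) (expr_steps a) (R1, M)" "represents R1 S"
    "R1 (tmp k) = eval a (S, M)" "\<forall>j<k. R1 (tmp j) = R (tmp j)"
    using Plus by blast
  obtain R2 where R2: "reaches (compile_expr (Suc k) b) (R1, M) (expr_steps b) (R2, M)" "represents R2 S"
    "R2 (tmp (Suc k)) = eval b (S, M)" "\<forall>j<Suc k. R2 (tmp j) = R1 (tmp j)"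
    using Plus.IH(2)[OF R1(2)] by blast
  show ?case
    using reaches_Seq[OF R1(1) reaches_Seq[OF R2(1) reaches_Add[of "tmp k" "tmp k" "tmp (Suc k)"]]] R1 R2
    by (auto simp: represents_def)
next
  case (Minus a b)
  obtain R1 where R1: "reaches (compile_expr k a) (R, M) (expr_steps a) (R1, M)" "represents R1 S"
    "R1 (tmp k) = eval a (S, M)" "\<forall>j<k. R1 (tmp j) = R (tmp j)"
    using Minus by blast
  obtain R2 where R2: "reaches (compile_expr (Suc k) b) (R1, M) (expr_steps b) (R2, M)" "represents R2 S"
    "R2 (tmp (Suc k)) = eval b (S, M)" "\<forall>j<Suc k. R2 (tmp j) = R1 (tmp j)"
    using Minus.IH(2)[OF R1(2)] by blast
  show ?case
    using reaches_Seq[OF R1(1) reaches_Seq[OF R2(1) reaches_Sub[of "tmp k" "tmp k" "tmp (Suc k)"]]] R1 R2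
    by (auto simp: represents_def)
next
  case (Mem a)
  obtain R1 where R1: "reaches (compile_expr k a) (R, M) (expr_steps a) (R1, M)" "represents R1 S"
    "R1 (tmp k) = eval a (S, M)" "\<forall>j<k. R1 (tmp j) = R (tmp j)"
    using Mem by blast
  show ?case
    using reaches_Seq[OF R1(1) reaches_Load[of "tmp k" "tmp k"]] R1
    by (auto simp: represents_def)
qed

text \<open>
  The counter of a loop is the named register itself; the temporary register that the while loop
  tests is computed anew as \<open>n\<close> minus the counter after each iteration, so loops can be nested
  without reserving registers.
\<close>

primrec compile :: "prog \<Rightarrow> com" where
  "compile Pass = Skip"
| "compile (x ::= e) = Seq (compile_expr 0 e) (Seq (Const (tmp 1) 0) (Add (reg x) (tmp 0) (tmp 1)))"
| "compile (Write a e) = Seq (compile_expr 0 a) (Seq (compile_expr 1 e) (Store (tmp 0) (tmp 1)))"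
| "compile (c ;; d) = Seq (compile c) (compile d)"
| "compile (Cond e c d) = Seq (compile_expr 0 e) (IfPos (tmp 0) (compile c) (compile d))"
| "compile (For x c) = Seq (Seq (Const (reg x) 0) (Sub (tmp 0) (reg Size) (reg x)))
    (WhilePos (tmp 0) (Seq (compile c)
      (Seq (Seq (Const (tmp 0) 1) (Add (reg x) (reg x) (tmp 0))) (Sub (tmp 0) (reg Size) (reg x)))))"

text \<open>
  The instruction count as a polynomial in the number \<open>n\<close> of loop iterations: a loop multiplies by
  the indeterminate. For a conditional the sum of both branches is a convenient upper bound.
\<close>

primrec steps :: "prog \<Rightarrow> nat poly" where
  "steps Pass = 1"
| "steps (x ::= e) = [:expr_steps e + (bit_size 0 + 1):]"
| "steps (Write a e) = [:expr_steps a + (expr_steps e + 1):]"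
| "steps (c ;; d) = steps c + steps d"
| "steps (Cond e c d) = [:expr_steps e + 1:] + (steps c + steps d)"
| "steps (For x c) = [:0, 1:] * (steps c + [:bit_size 1 + 3:]) + [:bit_size 0 + 2:]"

text \<open>
  The frame rule: it makes the effect of a subprogram on all other registers a syntactic question.
\<close>

lemma den_unwritten: "x \<notin> written c \<Longrightarrow> fst (den c s) x = fst s x"
proof (induction c arbitrary: s)
  case (For y c)
  have "fst (((\<lambda>s. set_var y (fst s y + 1) (den c s)) ^^ m) s) x = fst s x" for m s
    using For by (induction m arbitrary: s) (auto simp: set_var_def)
  then show ?case
    using For.prems by (simp add: set_var_def)
qed (auto simp: set_var_def)

lemma compile_correct:
  assumes "represents R (fst s)" "well_formed c" "fst s Size = int n"
    and "Size \<notin> written c"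
  shows "\<exists>R'. reaches (compile c) (R, snd s) (poly (steps c) n) (R', snd (den c s)) \<and>
    represents R' (fst (den c s))"
  using assms
proof (induction c arbitrary: R s)
  case Pass
  then show ?case
    using reaches_Skip[of "(R, snd s)"] by auto
next
  case (Assign x e)
  obtain R1 where R1: "reaches (compile_expr 0 e) (R, snd s) (expr_steps e) (R1, snd s)" "represents R1 (fst s)"
    "R1 (tmp 0) = eval e s"
    using compile_expr_correct[OF Assign.prems(1), of 0 e "snd s"] by auto
  show ?case
    using reaches_Seq[OF R1(1) reaches_Seq[OF reaches_Const[of "tmp 1" 0] reaches_Add[of "reg x" "tmp 0" "tmp 1"]]] R1
    by (auto simp: represents_def set_var_def)
next
  case (Write a e)
  obtain R1 where R1: "reaches (compile_expr 0 a) (R, snd s) (expr_steps a) (R1, snd s)" "represents R1 (fst s)"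
    "R1 (tmp 0) = eval a s"
    using compile_expr_correct[OF Write.prems(1), of 0 a "snd s"] by auto
  obtain R2 where R2: "reaches (compile_expr 1 e) (R1, snd s) (expr_steps e) (R2, snd s)" "represents R2 (fst s)"
    "R2 (tmp 1) = eval e s" "R2 (tmp 0) = R1 (tmp 0)"
    using compile_expr_correct[OF R1(2), of 1 e "snd s"] by auto
  have "R2 (tmp 0) = eval a s"
    using R1(3) R2(4) by simp
  then show ?case
    using reaches_Seq[OF R1(1) reaches_Seq[OF R2(1) reaches_Store[of "tmp 0" "tmp 1"]]] R2(2,3)
    by (intro exI[of _ R2]) (simp del: fun_upd_apply)
next
  case (Then c d)
  obtain R1 where R1: "reaches (compile c) (R, snd s) (poly (steps c) n) (R1, snd (den c s))"
    "represents R1 (fst (den c s))"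
    using Then.IH(1)[of R s] Then.prems by auto
  have "fst (den c s) Size = int n"
    using Then.prems by (simp add: den_unwritten)
  then obtain R2 where R2: "reaches (compile d) (R1, snd (den c s)) (poly (steps d) n) (R2, snd (den (c ;; d) s))"
    "represents R2 (fst (den (c ;; d) s))"
    using Then.IH(2)[OF R1(2)] Then.prems by auto
  show ?case
    using reaches_Seq[OF R1(1) R2(1)] R2(2) by auto
next
  case (Cond e c d)
  obtain R1 where R1: "reaches (compile_expr 0 e) (R, snd s) (expr_steps e) (R1, snd s)" "represents R1 (fst s)"
    "R1 (tmp 0) = eval e s"
    using compile_expr_correct[OF Cond.prems(1), of 0 e "snd s"] by auto
  let ?b = "if 0 < R1 (tmp 0) then c else d"
  obtain R2 where R2: "reaches (compile ?b) (R1, snd s) (poly (steps ?b) n) (R2, snd (den ?b s))"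
    "represents R2 (fst (den ?b s))"
    using Cond.IH(1)[OF R1(2)] Cond.IH(2)[OF R1(2)] Cond.prems by (cases "0 < R1 (tmp 0)") auto
  have "reaches (if 0 < R1 (tmp 0) then compile c else compile d) (R1, snd s) (poly (steps c + steps d) n) (R2, snd (den ?b s))"
    using reaches_mono[OF R2(1), of "poly (steps c + steps d) n"] by (auto split: if_splits)
  from reaches_Seq[OF R1(1) reaches_IfPos[where R=R1, OF this]] show ?case
    using R1(3) R2(2) by (intro exI[of _ R2]) (auto simp: ac_simps)
next
  case (For x c)
  let ?step = "\<lambda>s. set_var x (fst s x + 1) (den c s)"
  let ?test = "Sub (tmp 0) (reg Size) (reg x)"
  let ?inc = "Seq (Const (tmp 0) 1) (Add (reg x) (reg x) (tmp 0))"
  let ?body = "Seq (compile c) (Seq ?inc ?test)"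
  let ?k = "poly (steps c) n + (bit_size 1 + 1 + 1)"
  have wf: "x \<notin> written c" "Size \<notin> written c" "x \<noteq> Size" "well_formed c"
    using For.prems by auto
  \<comment> \<open>\<open>m\<close> is the number of iterations that are still to come.\<close>
  have loop: "\<exists>R'. reaches (WhilePos (tmp 0) ?body) (R, snd s) (m * (?k + 1) + 1) (R', snd ((?step ^^ m) s)) \<and>
      represents R' (fst ((?step ^^ m) s))"
    if "represents R (fst s)" "fst s Size = int n" "R (tmp 0) = int m" "fst s x = int n - int m" for m R s
    using that
  proof (induction m arbitrary: R s)
    case 0
    then show ?case
      using reaches_While_stop[of R "tmp 0"] by auto
  next
    case (Suc m)
    obtain R1 where R1: "reaches (compile c) (R, snd s) (poly (steps c) n) (R1, snd (den c s))"
      "represents R1 (fst (den c s))"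
      using For.IH[OF Suc.prems(1) wf(4) Suc.prems(2) wf(2)] by auto
    have unch: "fst (den c s) x = fst s x" "fst (den c s) Size = fst s Size"
      using wf by (auto simp: den_unwritten)
    let ?R2 = "R1(tmp 0 := 1, reg x := R1 (reg x) + 1, tmp 0 := R1 (reg Size) - (R1 (reg x) + 1))"
    have "reaches (Seq ?inc ?test) (R1, snd (den c s)) (bit_size 1 + 1 + 1) (?R2, snd (den c s))"
      using reaches_Seq[OF reaches_Seq[OF reaches_Const[of "tmp 0" 1 R1] reaches_Add[of "reg x" "reg x" "tmp 0"]]
          reaches_Sub[of "tmp 0" "reg Size" "reg x"]] wf(3)
      by (auto simp: fun_upd_twist)
    from reaches_Seq[OF R1(1) this]
    have body: "reaches ?body (R, snd s) ?k (?R2, snd (?step s))"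
      by (simp add: set_var_def)
    have "represents ?R2 (fst (?step s))"
      using R1(2) unch by (auto simp: represents_def set_var_def)
    moreover have "fst (?step s) Size = int n" "?R2 (tmp 0) = int m" "fst (?step s) x = int n - int m"
      using Suc.prems unch wf(3) R1(2) by (auto simp: set_var_def represents_def)
    ultimately obtain R3 where R3: "reaches (WhilePos (tmp 0) ?body) (?R2, snd (?step s)) (m * (?k + 1) + 1)
        (R3, snd ((?step ^^ m) (?step s)))" "represents R3 (fst ((?step ^^ m) (?step s)))"
      using Suc.IH by blast
    have "0 < R (tmp 0)"
      using Suc.prems by simp
    from reaches_While_step[of R, OF this body R3(1)]
    have "reaches (WhilePos (tmp 0) ?body) (R, snd s) (Suc m * (?k + 1) + 1)
        (R3, snd ((?step ^^ m) (?step s)))"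
      by (rule reaches_mono) simp
    moreover have unfold: "(?step ^^ Suc m) s = (?step ^^ m) (?step s)"
      by (simp only: funpow_Suc_right o_apply)
    ultimately show ?case
      unfolding unfold using R3(2) by blast
  qed
  let ?R0 = "R(reg x := 0, tmp 0 := R (reg Size))"
  have init: "reaches (Seq (Const (reg x) 0) ?test) (R, snd s) (bit_size 0 + 1) (?R0, snd s)"
    using reaches_Seq[OF reaches_Const[of "reg x" 0 R] reaches_Sub[of "tmp 0" "reg Size" "reg x"]] wf(3) by simp
  have "\<exists>R'. reaches (WhilePos (tmp 0) ?body) (?R0, snd (set_var x 0 s)) (n * (?k + 1) + 1)
      (R', snd ((?step ^^ n) (set_var x 0 s))) \<and> represents R' (fst ((?step ^^ n) (set_var x 0 s)))"
    by (rule loop) (use For.prems wf(3) in \<open>auto simp: represents_def set_var_def\<close>)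
  then obtain R' where R': "reaches (WhilePos (tmp 0) ?body) (?R0, snd s) (n * (?k + 1) + 1)
      (R', snd (den (For x c) s))" "represents R' (fst (den (For x c) s))"
    using For.prems(3) by (auto simp: set_var_def)
  have "bit_size 0 + 1 + (n * (?k + 1) + 1) = poly (steps (For x c)) n"
    by (simp add: algebra_simps)
  then have "reaches (compile (For x c)) (R, snd s) (poly (steps (For x c)) n) (R', snd (den (For x c) s))"
    unfolding compile.simps using reaches_Seq[OF init R'(1)] by metis
  then show ?case
    using R'(2) by blast
qed

lemma poly_nat_mono:
  fixes p :: "nat poly"
  assumes "a \<le> b"
  shows "poly p a \<le> poly p b"
  using assms by (induction p) (auto intro!: add_mono mult_mono)

lemma length_le_input_size: "length xs \<le> input_size xs"
  by (induction xs) (auto simp: input_size_def bit_size_def)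

lemma bit_size_le_input_size: "x \<in> set xs \<Longrightarrow> bit_size x \<le> input_size xs"
  unfolding input_size_def by (rule member_le_sum_list) simp_all

lemma bounded_initial: "bounded (input_size xs) (initial xs)"
proof -
  have "\<bar>x\<bar> \<le> 2 ^ input_size xs" if "x \<in> set xs" for x
  proof -
    have "(2::int) ^ bit_size x \<le> 2 ^ input_size xs"
      using bit_size_le_input_size[OF that] by (rule power_increasing) simp
    then show ?thesis
      using less_power_bit_size[of x] by linarith
  qed
  moreover have "int (length xs) \<le> 2 ^ input_size xs"
  proof -
    have "length xs < 2 ^ length xs" by (rule less_exp)
    also have "\<dots> \<le> 2 ^ input_size xs"
      using length_le_input_size by (rule power_increasing) simp
    finally have "int (length xs) < int (2 ^ input_size xs)"
      by (simp only: of_nat_less_iff)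
    then show ?thesis by simp
  qed
  ultimately show ?thesis
    by (auto simp: bounded_def initial_def)
qed

text \<open>
  A loop program without assignments to \<open>Size\<close> runs in polynomial time if the input starts with the
  number of loop iterations and is at least that long: the length bounds the iterations by the input
  size, and the input size also bounds the lengths of all numbers at the start.
\<close>

theorem solvable_by_loop_program:
  assumes c: "well_formed c" "Size \<notin> written c"
    and size: "\<And>x. x \<in> I \<Longrightarrow> enc_in x \<noteq> [] \<and> hd (enc_in x) = int (n x) \<and> n x \<le> length (enc_in x)"
    and correct: "\<And>x. x \<in> I \<Longrightarrow> \<exists>y. sol x y \<and>
      result (\<lambda>_. 0, snd (den c ((\<lambda>_. 0)(Size := int (n x)), snd (initial (enc_in x))))) = enc_out x y"
  shows "solvable_in_polynomial_time I enc_in sol enc_out"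
proof -
  let ?c = "Seq (Seq (Const (tmp 0) 1) (Load (reg Size) (tmp 0))) (compile c)"
  define q where "q = steps c + [:bit_size 1 + 1:]"
  \<comment> \<open>The bound of \<open>reaches\<close> for \<open>q\<close> instructions, when the numbers start with as many bits as the whole input.\<close>
  define p where "p = q * (2 * ([:0, 1:] + q) + 4)"
  have "\<exists>t s y. exec ?c (initial (enc_in x)) t s \<and> t \<le> poly p (input_size (enc_in x)) \<and>
      sol x y \<and> result s = enc_out x y" if x: "x \<in> I" for x
  proof -
    let ?xs = "enc_in x" let ?M = "snd (initial ?xs)" let ?b = "input_size ?xs"
    let ?s = "((\<lambda>_. 0)(Size := int (n x)), ?M)"
    let ?R = "(\<lambda>_. 0)(tmp 0 := 1, reg Size := int (n x))"
    have "?M 1 = int (n x)"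
      using size[OF x] by (cases ?xs) (auto simp: initial_def)
    then have "reaches (Seq (Const (tmp 0) 1) (Load (reg Size) (tmp 0))) (initial ?xs) (bit_size 1 + 1) (?R, ?M)"
      using reaches_Seq[OF reaches_Const[of "tmp 0" 1 "\<lambda>_. 0" ?M] reaches_Load[of "reg Size" "tmp 0"]]
      by (simp add: initial_def)
    moreover have "represents ?R (fst ?s)"
      by (auto simp: represents_def)
    then obtain R' where "reaches (compile c) (?R, ?M) (poly (steps c) (n x)) (R', snd (den c ?s))"
      using compile_correct[of ?R ?s c "n x"] c by auto
    ultimately have "reaches ?c (initial ?xs) (bit_size 1 + 1 + poly (steps c) (n x)) (R', snd (den c ?s))"
      by (rule reaches_Seq)
    moreover have "bit_size 1 + 1 + poly (steps c) (n x) \<le> poly q ?b"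
      using poly_nat_mono[of "n x" ?b "steps c"] size[OF x] length_le_input_size[of ?xs]
      by (auto simp: q_def)
    ultimately have "reaches ?c (initial ?xs) (poly q ?b) (R', snd (den c ?s))"
      by (rule reaches_mono)
    then obtain t where t: "exec ?c (initial ?xs) t (R', snd (den c ?s))"
      "t \<le> poly q ?b * (2 * (?b + poly q ?b) + 4)"
      using bounded_initial unfolding reaches_def by blast
    then have "t \<le> poly p ?b"
      by (simp add: p_def mult.commute)
    moreover obtain y where "sol x y" "result (\<lambda>_. 0, snd (den c ?s)) = enc_out x y"
      using correct[OF x] by blast
    ultimately show ?thesis
      using t(1) by (auto simp: result_def)
  qed
  then show ?thesis
    unfolding solvable_in_polynomial_time_def by blast
qed

section \<open>Digits and double counting\<close>

lemma digit_expansion_less: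
  fixes a :: "nat \<Rightarrow> nat"
  assumes "\<And>j. j < r \<Longrightarrow> a j < n"
  shows "(\<Sum>j<r. a j * n ^ j) < n ^ r"
  using assms
proof (induction r)
  case (Suc r)
  then have "(\<Sum>j<r. a j * n ^ j) < n ^ r" "a r + 1 \<le> n"
    by (auto simp: Suc_le_eq)
  then have "(\<Sum>j<r. a j * n ^ j) + a r * n ^ r < (a r + 1) * n ^ r"
    by simp
  also have "\<dots> \<le> n * n ^ r"
    using \<open>a r + 1 \<le> n\<close> by (rule mult_le_mono1)
  finally show ?case by simp
qed simp

lemma digit_add_high:
  fixes n :: nat
  assumes "k < r" "0 < n"
  shows "(a + m * n ^ r) div n ^ k mod n = a div n ^ k mod n"
proof -
  have "n ^ r = n ^ k * (n * n ^ (r - Suc k))"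
    using assms(1) by (metis Suc_diff_Suc le_add_diff_inverse less_imp_le power_Suc power_add)
  then have "m * n ^ r = n ^ k * (n * (m * n ^ (r - Suc k)))"
    by (metis mult.left_commute)
  then have "(a + m * n ^ r) div n ^ k mod n = (a + n ^ k * (n * (m * n ^ (r - Suc k)))) div n ^ k mod n"
    by (simp only:)
  also have "\<dots> = a div n ^ k mod n"
    using assms(2) by simp
  finally show ?thesis .
qed

lemma digit_of_expansion:
  fixes a :: "nat \<Rightarrow> nat"
  assumes "\<And>j. j < r \<Longrightarrow> a j < n" "k < r"
  shows "(\<Sum>j<r. a j * n ^ j) div n ^ k mod n = a k"
  using assms
proof (induction r)
  case (Suc r)
  have n: "n > 0"
    using Suc.prems by force
  show ?case
  proof (cases "k = r")
    case True
    then show ?thesis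
      using digit_expansion_less[of r a n] Suc.prems n by simp
  next
    case False
    then have "k < r"
      using Suc.prems by simp
    then show ?thesis
      using Suc n by (simp add: digit_add_high)
  qed
qed simp

lemma sum_swap_membership:
  assumes "\<And>k. k \<in> K \<Longrightarrow> A k \<subseteq> J" "finite K" "finite J"
  shows "(\<Sum>k\<in>K. \<Sum>j\<in>A k. g j) = (\<Sum>j\<in>J. card {k \<in> K. j \<in> A k} * (g j :: nat))"
proof -
  have "(\<Sum>k\<in>K. \<Sum>j\<in>A k. g j) = (\<Sum>k\<in>K. \<Sum>j\<in>J. if j \<in> A k then g j else 0)"
  proof (rule sum.cong[OF refl])
    fix k assume "k \<in> K"
    then have "J \<inter> A k = A k"
      using assms(1) by blast
    then show "(\<Sum>j\<in>A k. g j) = (\<Sum>j\<in>J. if j \<in> A k then g j else 0)"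
      using sum.inter_restrict[OF assms(3), of g "A k"] by simp
  qed
  also have "\<dots> = (\<Sum>j\<in>J. \<Sum>k\<in>K. if j \<in> A k then g j else 0)"
    by (rule sum.swap)
  also have "\<dots> = (\<Sum>j\<in>J. card {k \<in> K. j \<in> A k} * g j)"
    using assms(2) by (intro sum.cong refl) (simp add: sum.inter_filter[symmetric])
  finally show ?thesis .
qed

section \<open>The dynamic program\<close>

text \<open>
  \<open>adj\<close> is the adjacency relation of \<open>H\<close> on \<open>{0..<n}\<close>. The flag \<open>b\<close> that occurs below is the mode:
  true if all edges among the vertices from \<open>r\<close> on are taken, false if none of them is.
\<close>

locale degree_problem =
  fixes n r :: nat and adj :: "nat \<Rightarrow> nat \<Rightarrow> bool" and f :: "nat \<Rightarrow> nat \<Rightarrow> int"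
  assumes r_pos: "1 \<le> r" and r_le: "r \<le> n"
    and adj_sym: "adj i j \<Longrightarrow> adj j i" and adj_irrefl: "\<not> adj i i"
begin

definition deg :: "nat \<Rightarrow> nat" where
  "deg i = card {j. j < n \<and> adj i j}"

text \<open>
  The part of the degree of a vertex from \<open>r\<close> on that is fixed by the mode.
\<close>

definition base :: "bool \<Rightarrow> nat \<Rightarrow> nat" where
  "base b i = (if b then card {j. r \<le> j \<and> j < n \<and> adj i j} else 0)"

definition legal :: "nat \<Rightarrow> nat set \<Rightarrow> bool" where
  "legal i A \<longleftrightarrow> A \<subseteq> {j. j < r \<and> j < i \<and> adj i j}"

text \<open>
  A vertex \<open>i < r\<close> gains degree itself for each neighbour that it chooses; \<open>weight i\<close> is the
  contribution of one such edge to the code of the degree vector. Degrees of later vertices are not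
  part of the vector.
\<close>

definition weight :: "nat \<Rightarrow> nat" where
  "weight i = (if i < r then n ^ i else 0)"

definition shift :: "nat \<Rightarrow> nat set \<Rightarrow> nat" where
  "shift i A = (\<Sum>j\<in>A. n ^ j + weight i)"

text \<open>
  The value of a vertex below \<open>r\<close> is charged at the end, by \<open>terminal\<close>, because later vertices may
  still raise its degree.
\<close>

definition cost :: "bool \<Rightarrow> nat \<Rightarrow> nat set \<Rightarrow> int" where
  "cost b i A = (if i < r then 0 else f i (base b i + card A))"

definition terminal :: "nat \<Rightarrow> int" where
  "terminal c = (\<Sum>j<r. f j (c div n ^ j mod n))"

text \<open>
  \<open>opt b x c\<close> is the least cost of the remaining \<open>x\<close> vertices \<open>n - x, \<dots>, n - 1\<close>, the terminal cost
  included, if the choices made before have led to the degree vector with code \<open>c\<close>. The empty choice is always legal, so the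
  minimum is taken over a nonempty set.
\<close>

primrec opt :: "bool \<Rightarrow> nat \<Rightarrow> nat \<Rightarrow> int" where
  "opt b 0 c = terminal c"
| "opt b (Suc x) c =
    Min ((\<lambda>A. cost b (n - Suc x) A + opt b x (c + shift (n - Suc x) A)) ` Collect (legal (n - Suc x)))"

definition legal_choice :: "(nat \<Rightarrow> nat set) \<Rightarrow> bool" where
  "legal_choice \<alpha> \<longleftrightarrow> (\<forall>i<n. legal i (\<alpha> i))"

definition code :: "(nat \<Rightarrow> nat set) \<Rightarrow> nat \<Rightarrow> nat" where
  "code \<alpha> i = (\<Sum>k<i. shift k (\<alpha> k))"

text \<open>
  Codes that actually arise when \<open>x\<close> vertices remain. For other codes the table contains values
  without meaning: adding a shift to them may carry into the next digit or leave the layer.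
\<close>

definition reachable :: "nat \<Rightarrow> nat set" where
  "reachable x = {code \<alpha> (n - x) |\<alpha>. legal_choice \<alpha>}"

lemma n_pos: "0 < n"
  using r_pos r_le by simp

lemma legal_empty: "legal i {}"
  by (simp add: legal_def)

lemma finite_legal: "legal i A \<Longrightarrow> finite A"
  unfolding legal_def by (rule finite_subset[of _ "{..<r}"]) auto

lemma finite_Collect_legal: "finite (Collect (legal i))"
  by (rule finite_subset[of _ "Pow {..<r}"]) (auto simp: legal_def)

text \<open>
  The function of a vertex is only evaluated within the range of the input.
\<close>

lemma base_le_deg:
  assumes "legal i A" "i < n"
  shows "base b i + card A \<le> deg i"
proof -
  have "base b i + card A \<le> card {j. r \<le> j \<and> j < n \<and> adj i j} + card A"
    by (simp add: base_def)
  also have "\<dots> = card ({j. r \<le> j \<and> j < n \<and> adj i j} \<union> A)"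
    using assms finite_legal by (intro card_Un_disjoint[symmetric]) (auto simp: legal_def)
  also have "\<dots> \<le> deg i"
    unfolding deg_def using assms by (intro card_mono) (auto simp: legal_def)
  finally show ?thesis .
qed

lemma deg_less: "i < n \<Longrightarrow> deg i < n"
  using psubset_card_mono[of "{..<n}" "{j. j < n \<and> adj i j}"] adj_irrefl
  by (auto simp: deg_def)

text \<open>
  The degree that vertex \<open>j < r\<close> has from the choices of the vertices before \<open>i\<close>: once for every
  vertex that chose \<open>j\<close>, and, as soon as \<open>j\<close> itself has been processed, for its own choice.
\<close>

definition partial_degree :: "(nat \<Rightarrow> nat set) \<Rightarrow> nat \<Rightarrow> nat \<Rightarrow> nat" where
  "partial_degree \<alpha> i j = card {k \<in> {..<i}. j \<in> \<alpha> k} + (if j < i then card (\<alpha> j) else 0)"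

text \<open>
  Exchange the order of summation: collect the summands by the power of \<open>n\<close> instead of by the vertex
  that contributes them.
\<close>

lemma code_expansion:
  assumes "legal_choice \<alpha>" "i \<le> n"
  shows "code \<alpha> i = (\<Sum>j<r. partial_degree \<alpha> i j * n ^ j)"
proof -
  have leg: "legal k (\<alpha> k)" if "k < i" for k
    using assms that by (simp add: legal_choice_def)
  have "code \<alpha> i = (\<Sum>k<i. \<Sum>j\<in>\<alpha> k. n ^ j) + (\<Sum>k<i. card (\<alpha> k) * weight k)"
    by (simp add: code_def shift_def sum.distrib)
  also have "(\<Sum>k<i. \<Sum>j\<in>\<alpha> k. n ^ j) = (\<Sum>j<r. card {k \<in> {..<i}. j \<in> \<alpha> k} * n ^ j)"
    using leg by (intro sum_swap_membership) (auto simp: legal_def)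
  also have "(\<Sum>k<i. card (\<alpha> k) * weight k) = (\<Sum>k\<in>{..<i} \<inter> {..<r}. card (\<alpha> k) * n ^ k)"
    by (subst sum.inter_restrict) (auto simp: weight_def intro!: sum.cong)
  also have "\<dots> = (\<Sum>j<r. (if j < i then card (\<alpha> j) else 0) * n ^ j)"
    by (subst Int_commute, subst sum.inter_restrict) (auto intro!: sum.cong)
  finally show ?thesis
    by (simp add: partial_degree_def sum.distrib add_mult_distrib)
qed

text \<open>
  Vertices that choose \<open>j\<close> come after \<open>j\<close>, those that \<open>j\<close> chooses come before it; so no neighbour of
  \<open>j\<close> is counted twice. In particular the partial degrees are digits in base \<open>n\<close>.
\<close>

lemma partial_degree_le:
  assumes "legal_choice \<alpha>" "i \<le> n" "j < r"
  shows "partial_degree \<alpha> i j \<le> deg j"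
proof -
  let ?A = "{k \<in> {..<i}. j \<in> \<alpha> k}" and ?B = "if j < i then \<alpha> j else {}"
  have leg: "legal k (\<alpha> k)" if "k < n" for k
    using assms(1) that by (simp add: legal_choice_def)
  have A: "?A \<subseteq> {k. j < k \<and> k < n \<and> adj j k}"
  proof
    fix k assume "k \<in> ?A"
    then show "k \<in> {k. j < k \<and> k < n \<and> adj j k}"
      using leg[of k] assms(2) adj_sym[of k j] by (auto simp: legal_def)
  qed
  have B: "?B \<subseteq> {k. k < j \<and> k < n \<and> adj j k}"
    using leg[of j] assms(2,3) r_le by (auto simp: legal_def)
  have "?A \<subseteq> {j<..}" "?B \<subseteq> {..<j}"
    using A B by blast+
  from Int_mono[OF this] have "?A \<inter> ?B = {}"
    by (rule subset_empty[THEN iffD1, OF order_trans]) auto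
  then have "partial_degree \<alpha> i j = card (?A \<union> ?B)"
    using finite_subset[OF B] unfolding partial_degree_def
    by (subst card_Un_disjoint) auto
  also have "\<dots> \<le> deg j"
    unfolding deg_def using A B by (intro card_mono) auto
  finally show ?thesis .
qed

lemma partial_degree_less:
  assumes "legal_choice \<alpha>" "i \<le> n" "j < r"
  shows "partial_degree \<alpha> i j < n"
  using partial_degree_le[OF assms] deg_less[of j] assms(3) r_le by simp

lemma code_less: "legal_choice \<alpha> \<Longrightarrow> i \<le> n \<Longrightarrow> code \<alpha> i < n ^ r"
  by (simp add: code_expansion digit_expansion_less partial_degree_less)

lemma digit_code:
  "legal_choice \<alpha> \<Longrightarrow> i \<le> n \<Longrightarrow> j < r \<Longrightarrow> code \<alpha> i div n ^ j mod n = partial_degree \<alpha> i j"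
  by (simp add: code_expansion digit_of_expansion partial_degree_less)

lemma reachable_less: "c \<in> reachable x \<Longrightarrow> c < n ^ r"
  by (auto simp: reachable_def code_less)

lemma reachable_digit: "c \<in> reachable x \<Longrightarrow> j < r \<Longrightarrow> c div n ^ j mod n \<le> deg j"
  by (auto simp: reachable_def digit_code partial_degree_le)

lemma reachable_step:
  assumes "c \<in> reachable (Suc x)" "x < n" "legal (n - Suc x) A"
  shows "c + shift (n - Suc x) A \<in> reachable x"
proof -
  obtain \<alpha> where \<alpha>: "legal_choice \<alpha>" "c = code \<alpha> (n - Suc x)"
    using assms(1) by (auto simp: reachable_def)
  let ?\<beta> = "\<alpha>(n - Suc x := A)"
  have "n - x = Suc (n - Suc x)"
    using assms(2) by simp
  then have "code ?\<beta> (n - x) = c + shift (n - Suc x) A"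
    by (simp add: code_def \<alpha>(2))
  moreover have "legal_choice ?\<beta>"
    using \<alpha>(1) assms(3) by (simp add: legal_choice_def)
  ultimately show ?thesis
    unfolding reachable_def by (metis (mono_tags, lifting) mem_Collect_eq)
qed

lemma opt_le:
  assumes "legal_choice \<alpha>" "x \<le> n"
  shows "opt b x (code \<alpha> (n - x)) \<le> (\<Sum>k\<in>{n - x..<n}. cost b k (\<alpha> k)) + terminal (code \<alpha> n)"
  using assms(2)
proof (induction x)
  case (Suc x)
  let ?i = "n - Suc x"
  have i: "n - x = Suc ?i" "?i < n"
    using Suc.prems by auto
  have "opt b (Suc x) (code \<alpha> ?i) \<le> cost b ?i (\<alpha> ?i) + opt b x (code \<alpha> ?i + shift ?i (\<alpha> ?i))"
    using assms(1) i finite_Collect_legal by (auto simp: legal_choice_def intro!: Min_le)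
  also have "code \<alpha> ?i + shift ?i (\<alpha> ?i) = code \<alpha> (n - x)"
    by (simp add: i code_def)
  also have "opt b x (code \<alpha> (n - x)) \<le> (\<Sum>k\<in>{n - x..<n}. cost b k (\<alpha> k)) + terminal (code \<alpha> n)"
    using Suc by simp
  finally show ?case
    using i by (simp add: sum.atLeast_Suc_lessThan)
qed simp

text \<open>
  A choice function that attains the minimum in each layer attains the optimum as a whole, since its
  costs telescope along the layers.
\<close>

lemma opt_greedy:
  assumes "\<And>i. i < n \<Longrightarrow>
    opt b (n - i) (code \<alpha> i) = cost b i (\<alpha> i) + opt b (n - Suc i) (code \<alpha> (Suc i))"
  shows "opt b n 0 = (\<Sum>k<n. cost b k (\<alpha> k)) + terminal (code \<alpha> n)"
proof -
  have "opt b n 0 = (\<Sum>k<i. cost b k (\<alpha> k)) + opt b (n - i) (code \<alpha> i)" if "i \<le> n" for i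
    using that by (induction i) (auto simp: code_def[of \<alpha> 0] assms)
  from this[of n] show ?thesis by simp
qed

section \<open>From choices to subgraphs\<close>

text \<open>
  The neighbours of \<open>i\<close> in the subgraph that come before \<open>i\<close>: the chosen ones, and in true mode all
  neighbours from \<open>r\<close> on.
\<close>

definition earlier :: "bool \<Rightarrow> (nat \<Rightarrow> nat set) \<Rightarrow> nat \<Rightarrow> nat set" where
  "earlier b \<alpha> i = \<alpha> i \<union> {j. b \<and> r \<le> j \<and> j < i \<and> adj i j}"

definition edge :: "bool \<Rightarrow> (nat \<Rightarrow> nat set) \<Rightarrow> nat \<Rightarrow> nat \<Rightarrow> bool" where
  "edge b \<alpha> i j \<longleftrightarrow> j \<in> earlier b \<alpha> i \<or> i \<in> earlier b \<alpha> j"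

lemma edge_adj:
  assumes "legal_choice \<alpha>" "i < n" "j < n" "edge b \<alpha> i j"
  shows "adj i j"
proof -
  have "legal i (\<alpha> i)" "legal j (\<alpha> j)"
    using assms by (auto simp: legal_choice_def)
  then show ?thesis
    using assms(4) adj_sym by (auto simp: edge_def earlier_def legal_def)
qed

lemma edge_degree_arbitrary:
  assumes "legal_choice \<alpha>" "i < r"
  shows "card {j. j < n \<and> edge b \<alpha> i j} = partial_degree \<alpha> n i"
proof -
  have leg: "legal k (\<alpha> k)" if "k < n" for k
    using assms(1) that by (simp add: legal_choice_def)
  have i: "i < n"
    using assms(2) r_le by simp
  have A: "{k \<in> {..<n}. i \<in> \<alpha> k} \<subseteq> {k. i < k}"
    using leg by (fastforce simp: legal_def)
  have B: "\<alpha> i \<subseteq> {k. k < i}"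
    using leg[OF i] by (auto simp: legal_def)
  have "{j. j < n \<and> edge b \<alpha> i j} = {k \<in> {..<n}. i \<in> \<alpha> k} \<union> \<alpha> i"
    using assms(2) i B by (auto simp: edge_def earlier_def)
  moreover have "{k \<in> {..<n}. i \<in> \<alpha> k} \<inter> \<alpha> i = {}"
    using A B by fastforce
  ultimately show ?thesis
    using finite_legal[OF leg[OF i]] i unfolding partial_degree_def by (simp add: card_Un_disjoint)
qed

lemma edge_degree_monotone:
  assumes "legal_choice \<alpha>" "r \<le> i" "i < n"
  shows "card {j. j < n \<and> edge b \<alpha> i j} = base b i + card (\<alpha> i)"
proof -
  have leg: "legal k (\<alpha> k)" if "k < n" for k
    using assms(1) that by (simp add: legal_choice_def)
  have "{j. j < n \<and> edge b \<alpha> i j} = {j. b \<and> r \<le> j \<and> j < n \<and> adj i j} \<union> \<alpha> i"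
  proof (intro equalityI subsetI)
    fix j
    assume "j \<in> {j. j < n \<and> edge b \<alpha> i j}"
    then show "j \<in> {j. b \<and> r \<le> j \<and> j < n \<and> adj i j} \<union> \<alpha> i"
      using leg[of j] assms(2) adj_sym by (auto simp: edge_def earlier_def legal_def)
  next
    fix j
    assume "j \<in> {j. b \<and> r \<le> j \<and> j < n \<and> adj i j} \<union> \<alpha> i"
    then show "j \<in> {j. j < n \<and> edge b \<alpha> i j}"
      using leg[of i] assms(2,3) adj_sym adj_irrefl nat_neq_iff[of i j]
      by (auto simp: edge_def earlier_def legal_def)
  qed
  moreover have "{j. b \<and> r \<le> j \<and> j < n \<and> adj i j} \<inter> \<alpha> i = {}"
    using leg[OF assms(3)] by (auto simp: legal_def)
  ultimately show ?thesis
    using finite_legal[OF leg[OF assms(3)]] by (simp add: card_Un_disjoint base_def)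
qed

definition degree_cost :: "(nat \<Rightarrow> nat \<Rightarrow> bool) \<Rightarrow> int" where
  "degree_cost e = (\<Sum>i<n. f i (card {j. j < n \<and> e i j}))"

text \<open>
  The cost accumulated by the dynamic program is the objective value of the subgraph: the digits of
  the last code are the degrees below \<open>r\<close>, the other degrees have been charged vertex by vertex.
\<close>

lemma degree_cost_edge:
  assumes "legal_choice \<alpha>"
  shows "degree_cost (edge b \<alpha>) = (\<Sum>k<n. cost b k (\<alpha> k)) + terminal (code \<alpha> n)"
proof -
  have split: "{..<n} = {..<r} \<union> {r..<n}"
    using r_le by auto
  have "degree_cost (edge b \<alpha>) = (\<Sum>i<r. f i (partial_degree \<alpha> n i)) + (\<Sum>i\<in>{r..<n}. f i (base b i + card (\<alpha> i)))"
    unfolding degree_cost_def split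
    by (subst sum.union_disjoint)
       (auto simp: edge_degree_arbitrary[OF assms] edge_degree_monotone[OF assms])
  moreover have "(\<Sum>k<n. cost b k (\<alpha> k)) = (\<Sum>i\<in>{r..<n}. f i (base b i + card (\<alpha> i)))"
    unfolding split by (subst sum.union_disjoint) (auto simp: cost_def)
  moreover have "terminal (code \<alpha> n) = (\<Sum>i<r. f i (partial_degree \<alpha> n i))"
    by (simp add: terminal_def digit_code[OF assms])
  ultimately show ?thesis by simp
qed

lemma opt_le_degree_cost:
  assumes "legal_choice \<alpha>"
  shows "opt b n 0 \<le> degree_cost (edge b \<alpha>)"
  using opt_le[OF assms order_refl, of b] by (simp add: degree_cost_edge[OF assms] code_def[of _ 0] lessThan_atLeast0)

text \<open>
  The choices that reproduce those edges of a given subgraph which meet a vertex below \<open>r\<close>.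
\<close>

definition restriction :: "(nat \<Rightarrow> nat \<Rightarrow> bool) \<Rightarrow> nat \<Rightarrow> nat set" where
  "restriction e i = {j. j < r \<and> j < i \<and> e i j}"

lemma restriction_legal: "(\<And>i j. e i j \<Longrightarrow> adj i j) \<Longrightarrow> legal_choice (restriction e)"
  by (auto simp: legal_choice_def legal_def restriction_def)

lemma edge_restriction_arbitrary:
  assumes "\<And>i j. e i j \<Longrightarrow> e j i" "\<And>i j. e i j \<Longrightarrow> adj i j" "i < r" 
  shows "edge b (restriction e) i j \<longleftrightarrow> e i j"
proof -
  have "i \<noteq> j" if "e i j"
    using that assms(2) adj_irrefl by blast
  then show ?thesis
    using assms(1)[of i j] assms(1)[of j i] assms(3) by (auto simp: edge_def earlier_def restriction_def)
qed

lemma edge_restriction_False: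
  assumes "\<And>i j. e i j \<Longrightarrow> e j i" "edge False (restriction e) i j"
  shows "e i j"
  using assms(2) assms(1)[of j i] by (auto simp: edge_def earlier_def restriction_def)

lemma edge_restriction_True:
  assumes "\<And>i j. e i j \<Longrightarrow> e j i" "\<And>i j. e i j \<Longrightarrow> adj i j" "e i j"
  shows "edge True (restriction e) i j"
proof -
  have "i \<noteq> j"
    using assms adj_irrefl by blast
  then show ?thesis
    using assms(1)[OF assms(3)] assms(3) assms(2)[OF assms(3)] assms(2)[of j i]
    by (auto simp: edge_def earlier_def restriction_def)
qed

text \<open>
  The exchange argument. Replacing the edges among the vertices from \<open>r\<close> on by none of them, if the
  functions there are nondecreasing, or by all of them, if they are nonincreasing, keeps the degrees
  below \<open>r\<close> and does not raise any value; the result is a subgraph that the dynamic program has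
  considered in the respective mode.
\<close>

lemma opt_le_any:
  assumes sym: "\<And>i j. e i j \<Longrightarrow> e j i" and sub: "\<And>i j. e i j \<Longrightarrow> adj i j"
    and mono: "(\<forall>i\<in>{r..<n}. mono_on {0..deg i} (f i)) \<or> (\<forall>i\<in>{r..<n}. antimono_on {0..deg i} (f i))"
  shows "min (opt False n 0) (opt True n 0) \<le> degree_cost e"
proof -
  let ?d = "\<lambda>e i. card {j. j < n \<and> e i j}"
  note leg = restriction_legal[of e, OF sub]
  have deg: "?d e' i \<in> {0..deg i}" if "\<And>j. j < n \<Longrightarrow> e' i j \<Longrightarrow> adj i j" for e' i
    unfolding deg_def using that by (auto intro!: card_mono)
  have low: "?d (edge b (restriction e)) i = ?d e i" if "i < r" for b i
    using edge_restriction_arbitrary[of e, OF sym sub that] by simp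
  from mono show ?thesis
  proof
    assume m: "\<forall>i\<in>{r..<n}. mono_on {0..deg i} (f i)"
    have "f i (?d (edge False (restriction e)) i) \<le> f i (?d e i)" if "i < n" for i
    proof (cases "i < r")
      case False
      have "?d (edge False (restriction e)) i \<le> ?d e i"
        using edge_restriction_False[of e, OF sym] by (intro card_mono) auto
      moreover have "?d (edge False (restriction e)) i \<in> {0..deg i}" "?d e i \<in> {0..deg i}"
        using edge_adj[OF leg that] sub by (intro deg; blast)+
      ultimately show ?thesis
        using m False that by (auto simp: monotone_on_def)
    qed (simp add: low)
    then have "degree_cost (edge False (restriction e)) \<le> degree_cost e"
      unfolding degree_cost_def by (intro sum_mono) auto
    then show ?thesis
      using opt_le_degree_cost[OF leg, of False] by simp
  next
    assume m: "\<forall>i\<in>{r..<n}. antimono_on {0..deg i} (f i)"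
    have "f i (?d (edge True (restriction e)) i) \<le> f i (?d e i)" if "i < n" for i
    proof (cases "i < r")
      case False
      have "?d e i \<le> ?d (edge True (restriction e)) i"
        using edge_restriction_True[of e, OF sym sub] by (intro card_mono) auto
      moreover have "?d (edge True (restriction e)) i \<in> {0..deg i}" "?d e i \<in> {0..deg i}"
        using edge_adj[OF leg that] sub by (intro deg; blast)+
      ultimately show ?thesis
        using m False that by (auto simp: monotone_on_def)
    qed (simp add: low)
    then have "degree_cost (edge True (restriction e)) \<le> degree_cost e"
      unfolding degree_cost_def by (intro sum_mono) auto
    then show ?thesis
      using opt_le_degree_cost[OF leg, of True] by simp
  qed
qed

end

section \<open>Invariants for loop programs\<close>

lemma fst_set_var [simp]: "fst (set_var x k s) y = (if y = x then k else fst s y)"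
  by (simp add: set_var_def)

lemma snd_set_var [simp]: "snd (set_var x k s) = snd s"
  by (simp add: set_var_def)

primrec silent :: "prog \<Rightarrow> bool" where
  "silent Pass = True"
| "silent (x ::= e) = True"
| "silent (Write a e) = False"
| "silent (c ;; d) = (silent c \<and> silent d)"
| "silent (Cond e c d) = (silent c \<and> silent d)"
| "silent (For x c) = silent c"

lemma den_silent [simp]: "silent c \<Longrightarrow> snd (den c s) = snd s"
proof (induction c arbitrary: s)
  case (For y c)
  have "snd (((\<lambda>s. set_var y (fst s y + 1) (den c s)) ^^ m) s) = snd s" for m s
    using For by (induction m arbitrary: s) auto
  then show ?case by simp
qed auto

declare den_unwritten [simp]

text \<open>
  Besides the invariant, the step may use the counter value and the frame of the loop body, so
  invariants need to mention only what the body changes.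
\<close>

lemma den_For_invariant:
  assumes "well_formed (For x c)" "fst s Size = int n"
    and init: "P 0 (set_var x 0 s)"
    and step: "\<And>k t. k < n \<Longrightarrow> P k t \<Longrightarrow> fst t x = int k \<Longrightarrow>
      (\<And>y. y \<notin> insert x (written c) \<Longrightarrow> fst t y = fst s y) \<Longrightarrow> (silent c \<Longrightarrow> snd t = snd s) \<Longrightarrow>
      P (Suc k) (set_var x (int k + 1) (den c t))"
  shows "P n (den (For x c) s)"
proof -
  let ?step = "\<lambda>t. set_var x (fst t x + 1) (den c t)"
  let ?t = "\<lambda>k. (?step ^^ k) (set_var x 0 s)"
  have "P k (?t k) \<and> fst (?t k) x = int k \<and> (\<forall>y. y \<notin> insert x (written c) \<longrightarrow> fst (?t k) y = fst s y) \<and>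
      (silent c \<longrightarrow> snd (?t k) = snd s)" if "k \<le> n" for k
    using that
  proof (induction k)
    case 0
    then show ?case using init by simp
  next
    case (Suc k)
    then have IH: "k < n" "P k (?t k)" "fst (?t k) x = int k"
      "\<forall>y. y \<notin> insert x (written c) \<longrightarrow> fst (?t k) y = fst s y" "silent c \<longrightarrow> snd (?t k) = snd s"
      by auto
    have "?t (Suc k) = set_var x (int k + 1) (den c (?t k))"
      using IH(3) assms(1) by simp
    then show ?case
      using step[of k "?t k"] IH assms(1) by simp
  qed
  from this[of n] show ?thesis
    using assms(2) by simp
qed

text \<open>
  Loops over a fixed list are unrolled; this is how \<open>r\<close> and the subsets of \<open>{..<r}\<close> enter the
  program text.
\<close>

primrec each :: "('a \<Rightarrow> prog) \<Rightarrow> 'a list \<Rightarrow> prog" where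
  "each c [] = Pass"
| "each c (x # xs) = c x ;; each c xs"

lemma written_each [simp]: "written (each c xs) = (\<Union>x\<in>set xs. written (c x))"
  by (induction xs) auto

lemma well_formed_each [simp]: "well_formed (each c xs) \<longleftrightarrow> (\<forall>x\<in>set xs. well_formed (c x))"
  by (induction xs) auto

lemma silent_each [simp]: "silent (each c xs) \<longleftrightarrow> (\<forall>x\<in>set xs. silent (c x))"
  by (induction xs) auto

lemma den_each_append: "den (each c (xs @ ys)) s = den (each c ys) (den (each c xs) s)"
  by (induction xs arbitrary: s) auto

lemma den_each_invariant:
  assumes init: "P [] s"
    and step: "\<And>ys x zs t. xs = ys @ x # zs \<Longrightarrow> P ys t \<Longrightarrow>
      (\<And>y. (\<forall>x\<in>set xs. y \<notin> written (c x)) \<Longrightarrow> fst t y = fst s y) \<Longrightarrow>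
      ((\<forall>x\<in>set xs. silent (c x)) \<Longrightarrow> snd t = snd s) \<Longrightarrow> P (ys @ [x]) (den (c x) t)"
  shows "P xs (den (each c xs) s)"
proof -
  have "P ys (den (each c ys) s)" if "xs = ys @ zs" for ys zs
    using that
  proof (induction ys arbitrary: zs rule: rev_induct)
    case Nil
    then show ?case using init by simp
  next
    case (snoc x ys)
    then have xs: "xs = ys @ x # zs" by simp
    have "P (ys @ [x]) (den (c x) (den (each c ys) s))"
      by (rule step[OF xs]) (use snoc.IH[OF xs] in \<open>auto simp: xs\<close>)
    then show ?case
      by (simp add: den_each_append)
  qed
  from this[of xs "[]"] show ?thesis by simp
qed

lemma den_each_upt_invariant:
  assumes init: "P 0 s"
    and step: "\<And>j t. j < m \<Longrightarrow> P j t \<Longrightarrow>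
      (\<And>y. (\<forall>j<m. y \<notin> written (c j)) \<Longrightarrow> fst t y = fst s y) \<Longrightarrow>
      ((\<forall>j<m. silent (c j)) \<Longrightarrow> snd t = snd s) \<Longrightarrow> P (Suc j) (den (c j) t)"
  shows "P m (den (each c [0..<m]) s)"
proof -
  have "P (length [0..<m]) (den (each c [0..<m]) s)"
  proof (rule den_each_invariant[where P = "\<lambda>ys. P (length ys)"])
    fix ys x zs t
    assume xs: "[0..<m] = ys @ x # zs"
    have "m = length ys + Suc (length zs)"
      using arg_cong[OF xs, of length] by simp
    moreover have "[0..<m] ! length ys = x"
      by (simp add: xs)
    ultimately have x: "x = length ys" "x < m"
      by (simp_all del: upt_Suc)
    assume "P (length ys) t"
      "\<And>y. (\<forall>x\<in>set [0..<m]. y \<notin> written (c x)) \<Longrightarrow> fst t y = fst s y"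
      "(\<forall>x\<in>set [0..<m]. silent (c x)) \<Longrightarrow> snd t = snd s"
    then show "P (length (ys @ [x])) (den (c x) t)"
      using step[of x t] x by simp
  qed (use init in simp)
  then show ?thesis by simp
qed

text \<open>
  Runs \<open>c\<close> exactly \<open>n ^ k\<close> times although every single loop makes only \<open>n\<close> iterations. Since the
  innermost loop varies the lowest digit, the registers \<open>Digit j\<close> run through the codes
  \<open>0, \<dots>, n ^ k - 1\<close> in increasing order.
\<close>

primrec nest :: "nat \<Rightarrow> prog \<Rightarrow> prog" where
  "nest 0 c = c"
| "nest (Suc k) c = For (Digit k) (nest k c)"

lemma written_nest [simp]: "written (nest k c) = Digit ` {..<k} \<union> written c"
  by (induction k) (auto simp: lessThan_Suc)

lemma well_formed_nest [simp]:
  "well_formed c \<Longrightarrow> (\<And>j. Digit j \<notin> written c) \<Longrightarrow> Size \<notin> written c \<Longrightarrow> well_formed (nest k c)"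
  by (induction k) auto

text \<open>
  The invariant is indexed by the number of iterations made so far, which is also the code whose
  digits are in the digit registers. The induction on \<open>k\<close> fixes the top digit.
\<close>

lemma den_nest_invariant:
  assumes wf: "well_formed c" "\<And>j. Digit j \<notin> written c" "Size \<notin> written c"
    and "fst s Size = int n" "P 0 s"
    and "\<And>a j v t. j < k \<Longrightarrow> P a t \<Longrightarrow> P a (set_var (Digit j) v t)"
    and "\<And>a t. a < n ^ k \<Longrightarrow> P a t \<Longrightarrow> (\<And>j. j < k \<Longrightarrow> fst t (Digit j) = int (a div n ^ j mod n)) \<Longrightarrow>
      P (Suc a) (den c t)"
  shows "P (n ^ k) (den (nest k c) s)"
  using assms(4-)
proof (induction k arbitrary: P s)
  case 0
  then show ?case
    using "0.prems"(4)[of 0 s] by simp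
next
  case (Suc k)
  have "P (n * n ^ k) (den (For (Digit k) (nest k c)) s)"
  proof (rule den_For_invariant[where P = "\<lambda>m. P (m * n ^ k)"])
    show "well_formed (For (Digit k) (nest k c))"
      using wf by auto
    show "fst s Size = int n" by fact
    show "P (0 * n ^ k) (set_var (Digit k) 0 s)"
      using Suc.prems by simp
    fix m t
    assume m: "m < n" and P: "P (m * n ^ k) t" and Dk: "fst t (Digit k) = int m"
      and frame: "\<And>y. y \<notin> insert (Digit k) (written (nest k c)) \<Longrightarrow> fst t y = fst s y"
    \<comment> \<open>The inner loops run through the codes with top digit \<open>m\<close>.\<close>
    let ?Q = "\<lambda>a u. P (m * n ^ k + a) u \<and> fst u (Digit k) = int m"
    have "?Q (n ^ k) (den (nest k c) t)"
    proof (rule Suc.IH[where P = ?Q])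
      show "fst t Size = int n"
        using frame[of Size] wf(3) Suc.prems(1) by auto
      show "?Q 0 t"
        using P Dk by simp
      show "?Q a (set_var (Digit j) v u)" if "j < k" "?Q a u" for a j v u
        using that Suc.prems(3) by simp
      fix a u
      assume a: "a < n ^ k" and Q: "?Q a u"
        and dig: "\<And>j. j < k \<Longrightarrow> fst u (Digit j) = int (a div n ^ j mod n)"
      have "P (Suc (m * n ^ k + a)) (den c u)"
      proof (rule Suc.prems(4))
        have "m * n ^ k + a < (m + 1) * n ^ k"
          using a by simp
        also have "\<dots> \<le> n * n ^ k"
          using m by (intro mult_le_mono1) simp
        finally show "m * n ^ k + a < n ^ Suc k" by simp
        show "P (m * n ^ k + a) u"
          using Q by simp
        fix j
        assume "j < Suc k"
        then consider "j = k" | "j < k" by linarith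
        then show "fst u (Digit j) = int ((m * n ^ k + a) div n ^ j mod n)"
        proof cases
          case 1
          then show ?thesis
            using Q a m by simp
        next
          case 2
          then show ?thesis
            using dig[OF 2] m digit_add_high[of j k n a m] by (simp add: add.commute)
        qed
      qed
      then show "?Q (Suc a) (den c u)"
        using Q wf(2) by simp
    qed
    then show "P (Suc m * n ^ k) (set_var (Digit k) (int m + 1) (den (nest k c) t))"
      using Suc.prems(3)[of k] by (simp add: add.commute)
  qed
  then show ?case by simp
qed

section \<open>The program\<close>

text \<open>
  Loops are treated by invariants and never unfolded. Whether a register belongs to a family such
  as \<open>Chosen ` {..<r}\<close> is decided by its constructor once membership in the image is spelled out.
\<close>

declare den.simps(6) [simp del] image_iff [simp]

text \<open>
  Computes the data of the current vertex \<open>i\<close>: the address of its row of the adjacency matrix, the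
  address of its list of function values (all lists of earlier vertices have to be skipped, and their
  lengths are degrees plus one), \<open>base b i\<close>, and \<open>weight i\<close>. There is no multiplication, hence the
  loop for the row; \<open>n\<close> squared is added to \<open>FunPtr\<close> in passing, by counting the cells of the
  matrix. A difference is positive iff its first argument is larger, which explains offsets such as
  \<open>Num (int r - 1)\<close> in the test for \<open>r \<le> j\<close>.
\<close>

definition prepare :: "nat \<Rightarrow> prog" where
  "prepare r =
     (Row ::= Num 2 ;; For Loop2 (Row ::= Var Row [+] Var Vertex)) ;;
     (FunPtr ::= Num 2 [+] Var Vertex ;; Ptr ::= Num 2 ;;
      For Loop2 (For Loop3 (
        FunPtr ::= Var FunPtr [+] Num 1 ;;
        Cond (Var Vertex [-] Var Loop2) (FunPtr ::= Var FunPtr [+] Mem (Var Ptr)) Pass ;;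
        Ptr ::= Var Ptr [+] Num 1))) ;;
     (Base ::= Num 0 ;;
      Cond (Var Mode)
        (For Loop2 (Cond (Var Loop2 [-] Num (int r - 1))
          (Base ::= Var Base [+] Mem (Var Row [+] Var Loop2)) Pass)) Pass) ;;
     (Weight ::= Num 0 ;;
      each (\<lambda>j. Cond (Var Vertex [-] Num (int j - 1))
        (Cond (Num (int j + 1) [-] Var Vertex) (Weight ::= Var (Power j)) Pass) Pass) [0..<r])"

definition check_legal :: "nat list \<Rightarrow> prog" where
  "check_legal A =
     Legal ::= Num 1 ;;
     each (\<lambda>j. Cond (Var Vertex [-] Num (int j))
       (Cond (Mem (Var Row [+] Num (int j))) Pass (Legal ::= Num 0)) (Legal ::= Num 0)) A"

definition compute_shift :: "nat list \<Rightarrow> prog" where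
  "compute_shift A =
     Shift ::= Num 0 ;;
     each (\<lambda>j. Shift ::= Var Shift [+] (Var (Power j) [+] Var Weight)) A"

text \<open>
  The tables grow downwards in the negative cells, where the input is safe: entry \<open>c\<close> of layer \<open>x\<close>
  is in cell \<open>- 1 - (x * n ^ r + c)\<close>. If \<open>Pos\<close> is the position of the entry in question,
  \<open>Pos - LayerSize + Shift\<close> is the position in the layer below to which the choice leads.
\<close>

definition compute_value :: "nat \<Rightarrow> nat list \<Rightarrow> prog" where
  "compute_value r A =
     Val ::= Mem (Num (-1) [-] (Var Pos [-] Var LayerSize [+] Var Shift)) ;;
     Cond (Var Vertex [-] Num (int r - 1))
       (Val ::= Var Val [+] Mem (Var FunPtr [+] Var Base [+] Num (int (length A)))) Pass"

definition evaluate :: "nat \<Rightarrow> nat list \<Rightarrow> prog" where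
  "evaluate r A = check_legal A ;; compute_shift A ;; compute_value r A"

definition accept :: "nat \<Rightarrow> nat list \<Rightarrow> prog" where
  "accept r A =
     Best ::= Var Val ;; BestShift ::= Var Shift ;;
     each (\<lambda>j. Chosen j ::= Num (of_bool (j \<in> set A))) [0..<r]"

text \<open>
  The empty choice is legal at every vertex and initializes the search.
\<close>

definition best_choice :: "nat \<Rightarrow> prog" where
  "best_choice r =
     evaluate r [] ;; accept r [] ;;
     each (\<lambda>A. evaluate r A ;;
       Cond (Var Legal) (Cond (Var Best [-] Var Val) (accept r A) Pass) Pass) (subseqs [0..<r])"

definition compute_terminal :: "nat \<Rightarrow> prog" where
  "compute_terminal r =
     Acc ::= Num 0 ;;
     each (\<lambda>j. Vertex ::= Num (int j) ;; prepare r ;;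
       Acc ::= Var Acc [+] Mem (Var FunPtr [+] Var (Digit j))) [0..<r]"

definition emit :: "var \<Rightarrow> prog" where
  "emit x = Write (Num (-1) [-] Var Pos) (Var x) ;; Pos ::= Var Pos [+] Num 1"

text \<open>
  Layer 0 first, then layer by layer; the layer written in iteration \<open>k\<close> of the outer loop is
  layer \<open>k + 1\<close>, which belongs to the vertex \<open>n - 1 - k\<close>. \<open>Pos\<close> is a running position through all
  layers.
\<close>

definition fill :: "nat \<Rightarrow> prog" where
  "fill r =
     Pos ::= Num 0 ;;
     nest r (compute_terminal r ;; emit Acc) ;;
     For Loop0 (
       Vertex ::= Var Size [-] Num 1 [-] Var Loop0 ;; prepare r ;;
       nest r (best_choice r ;; emit Best))"

definition powers :: "nat \<Rightarrow> prog" where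
  "powers r =
     (Power 0 ::= Num 1 ;;
      each (\<lambda>j. Power (Suc j) ::= Num 0 ;;
        For Loop0 (Power (Suc j) ::= Var (Power (Suc j)) [+] Var (Power j))) [0..<r]) ;;
     LayerSize ::= Var (Power r)"

text \<open>
  Records the earlier neighbours of the current vertex \<open>i\<close> as a 0-1 row beyond the tables, at the
  positions \<open>Out + i * n + j\<close>. As \<open>Row\<close> is \<open>2 + i * n\<close>, the address \<open>- 1 - position\<close> turns into
  \<open>1 - (Out + Row + j)\<close>.
\<close>

definition write_row :: "nat \<Rightarrow> prog" where
  "write_row r =
     each (\<lambda>j. Write (Num 1 [-] (Var Out [+] Var Row [+] Num (int j))) (Var (Chosen j))) [0..<r] ;;
     Cond (Var Mode)
       (For Loop1 (Cond (Var Vertex [-] Var Loop1) (Cond (Var Loop1 [-] Num (int r - 1))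
         (Write (Num 1 [-] (Var Out [+] Var Row [+] Var Loop1)) (Mem (Var Row [+] Var Loop1)))
         Pass) Pass)) Pass"

text \<open>
  Starts from the code 0 in the top layer and repeats at each vertex the search for the best choice,
  since the tables contain the values only.
\<close>

definition reconstruct :: "nat \<Rightarrow> prog" where
  "reconstruct r =
     Out ::= Var Pos ;; Pos ::= Var Pos [-] Var LayerSize ;;
     For Loop0 (
       Vertex ::= Var Loop0 ;; prepare r ;; best_choice r ;;
       Pos ::= Var Pos [-] Var LayerSize [+] Var BestShift ;;
       write_row r)"

text \<open>
  The recorded matrix is strictly lower triangular, so the adjacency matrix is its sum with its
  transpose. Entry \<open>(i, j)\<close> is at position \<open>Ptr - 1\<close> of the record and the transposed one at
  \<open>Acc = i + n * j\<close>. The input is overwritten only here.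
\<close>

definition print_graph :: prog where
  "print_graph =
     Ptr ::= Num 1 ;;
     For Loop0 (For Loop1 (
       Acc ::= Var Loop0 ;; For Loop2 (Acc ::= Var Acc [+] Var Loop1) ;;
       Write (Var Ptr) (Mem (Num 0 [-] (Var Out [+] Var Ptr)) [+] Mem (Num (-1) [-] (Var Out [+] Var Acc))) ;;
       Ptr ::= Var Ptr [+] Num 1)) ;;
     Write (Num 0) (Var Ptr [-] Num 1)"

section \<open>Choosing the earlier neighbours of a vertex\<close>

lemma written_prepare [simp]: "written (prepare r) = {Row, FunPtr, Ptr, Base, Weight, Loop2, Loop3}"
  by (auto simp: prepare_def)

lemma written_check_legal: "written (check_legal A) = {Legal}"
  by (auto simp: check_legal_def)

lemma written_compute_shift: "written (compute_shift A) = {Shift}"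
  by (auto simp: compute_shift_def)

lemma written_compute_value: "written (compute_value r A) = {Val}"
  by (auto simp: compute_value_def)

lemma silent_parts: "silent (check_legal A)" "silent (compute_shift A)" "silent (compute_value r A)"
  by (simp_all add: check_legal_def compute_shift_def compute_value_def)

lemmas evaluate_parts = written_check_legal written_compute_shift written_compute_value silent_parts

lemma written_evaluate [simp]: "written (evaluate r A) = {Legal, Shift, Val}"
  by (auto simp: evaluate_def evaluate_parts)

lemma written_accept [simp]: "written (accept r A) = {Best, BestShift} \<union> Chosen ` {..<r}"
  by (auto simp: accept_def)

lemma written_best_choice [simp]:
  "written (best_choice r) = {Legal, Shift, Val, Best, BestShift} \<union> Chosen ` {..<r}"
  by (auto simp: best_choice_def)

lemma silent_prepare [simp]: "silent (prepare r)"
  by (simp add: prepare_def)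

lemma silent_evaluate [simp]: "silent (evaluate r A)"
  by (simp add: evaluate_def evaluate_parts)

lemma silent_accept [simp]: "silent (accept r A)"
  by (simp add: accept_def)

lemma silent_best_choice [simp]: "silent (best_choice r)"
  by (simp add: best_choice_def)

lemma well_formed_prepare [simp]: "well_formed (prepare r)"
  by (simp add: prepare_def)

lemma well_formed_evaluate [simp]: "well_formed (evaluate r A)"
  by (simp add: evaluate_def check_legal_def compute_shift_def compute_value_def)

lemma well_formed_accept [simp]: "well_formed (accept r A)"
  by (simp add: accept_def)

lemma well_formed_best_choice [simp]: "well_formed (best_choice r)"
  by (simp add: best_choice_def)

lemma multiple_loop:
  assumes "well_formed (For x (y ::= Var y [+] Var z))" "x \<noteq> y" "y \<noteq> z" "x \<noteq> z" "fst s Size = int n"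
  shows "fst (den (For x (y ::= Var y [+] Var z)) s) y = fst s y + int n * fst s z"
  by (rule den_For_invariant[where P = "\<lambda>k t. fst t y = fst s y + int k * fst s z"])
     (use assms in \<open>auto simp: algebra_simps\<close>)

lemma card_less_Suc_filter: "card {j. j < Suc m \<and> P j} = card {j. j < m \<and> P j} + of_bool (P m)"
proof -
  have "{j. j < Suc m \<and> P j} = (if P m then insert m {j. j < m \<and> P j} else {j. j < m \<and> P j})"
    by (auto simp: less_Suc_eq)
  then show ?thesis by simp
qed

context degree_problem
begin

text \<open>
  The cell with the value at 0 of the function of vertex \<open>i\<close>: cell 0 holds the length of the input,
  cell 1 the number \<open>n\<close>, and the matrix starts in cell 2.
\<close>

definition fun_ptr :: "nat \<Rightarrow> nat" where
  "fun_ptr i = 2 + n * n + i + (\<Sum>k<i. deg k)"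

text \<open>
  The part of the input on which the program relies; only cells with nonnegative addresses matter.
\<close>

definition input :: "(int \<Rightarrow> int) \<Rightarrow> bool" where
  "input M \<longleftrightarrow> (\<forall>i<n. \<forall>j<n. M (int (2 + i * n + j)) = of_bool (adj i j)) \<and>
     (\<forall>i<n. \<forall>d\<le>deg i. M (int (fun_ptr i + d)) = f i d)"

text \<open>
  What stays true while one mode is being processed.
\<close>

definition config :: "bool \<Rightarrow> store \<Rightarrow> bool" where
  "config b s \<longleftrightarrow> fst s Size = int n \<and> fst s Mode = of_bool b \<and> (\<forall>j<r. fst s (Power j) = int (n ^ j)) \<and>
     fst s LayerSize = int (n ^ r) \<and> input (snd s)"

text \<open>
  The state after \<open>prepare\<close> at vertex \<open>i\<close>.
\<close>

definition ready :: "bool \<Rightarrow> nat \<Rightarrow> store \<Rightarrow> bool" where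
  "ready b i s \<longleftrightarrow> config b s \<and> fst s Vertex = int i \<and> fst s Row = int (2 + i * n) \<and>
     fst s FunPtr = int (fun_ptr i) \<and> fst s Base = int (base b i) \<and> fst s Weight = int (weight i)"

lemma input_adj: "input M \<Longrightarrow> i < n \<Longrightarrow> j < n \<Longrightarrow> M (2 + int i * int n + int j) = of_bool (adj i j)"
  by (simp add: input_def add.assoc)

lemma input_fun: "input M \<Longrightarrow> i < n \<Longrightarrow> d \<le> deg i \<Longrightarrow> M (int (fun_ptr i) + int d) = f i d"
  by (simp add: input_def)

lemma fun_ptr_loop:
  assumes inp: "input (snd s)" and size: "fst s Size = int n" and v: "fst s Vertex = int i" "i < n"
    and "fst s FunPtr = 2 + int i" "fst s Ptr = 2"
  shows "fst (den (For Loop2 (For Loop3 (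
        FunPtr ::= Var FunPtr [+] Num 1 ;;
        Cond (Var Vertex [-] Var Loop2) (FunPtr ::= Var FunPtr [+] Mem (Var Ptr)) Pass ;;
        Ptr ::= Var Ptr [+] Num 1))) s) FunPtr = int (fun_ptr i)"
    (is "fst (den (For Loop2 (For Loop3 ?c)) s) FunPtr = _")
proof -
  let ?P = "\<lambda>k t. fst t Ptr = int (2 + k * n) \<and>
    fst t FunPtr = int (2 + i + k * n + (\<Sum>m<min k i. deg m))"
  have "?P n (den (For Loop2 (For Loop3 ?c)) s)"
  proof (rule den_For_invariant[where P = ?P])
    fix k and t :: store
    assume k: "k < n" and P: "?P k t" and loop: "fst t Loop2 = int k"
      and fr: "\<And>y. y \<notin> insert Loop2 (written (For Loop3 ?c)) \<Longrightarrow> fst t y = fst s y"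
      and sil: "silent (For Loop3 ?c) \<Longrightarrow> snd t = snd s"
    have t: "fst t Size = int n" "fst t Vertex = int i" "snd t = snd s"
      using fr[of Size] fr[of Vertex] sil size v by auto
    let ?Q = "\<lambda>m u. fst u Ptr = int (2 + k * n + m) \<and>
      fst u FunPtr = int (2 + i + k * n + (\<Sum>m<min k i. deg m) + m +
        (if k < i then card {j. j < m \<and> adj k j} else 0))"
    have "?Q n (den (For Loop3 ?c) t)"
    proof (rule den_For_invariant[where P = ?Q])
      fix m and u :: store
      assume m: "m < n" and Q: "?Q m u"
        and fru: "\<And>y. y \<notin> insert Loop3 (written ?c) \<Longrightarrow> fst u y = fst t y"
        and silu: "silent ?c \<Longrightarrow> snd u = snd t"
      have u: "fst u Vertex = int i" "fst u Loop2 = int k" "snd u = snd s"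
        using fru[of Vertex] fru[of Loop2] silu t loop by auto
      have "snd u (fst u Ptr) = of_bool (adj k m)"
        using inp k m Q u(3) by (auto simp: input_def)
      then show "?Q (Suc m) (set_var Loop3 (int m + 1) (den ?c u))"
        using Q u by (simp add: card_less_Suc_filter)
    qed (use t P in auto)
    moreover have "(\<Sum>m<min (Suc k) i. deg m) = (\<Sum>m<min k i. deg m) + (if k < i then deg k else 0)"
      by (auto simp: min_def not_le less_Suc_eq_le le_Suc_eq)
    ultimately show "?P (Suc k) (set_var Loop2 (int k + 1) (den (For Loop3 ?c) t))"
      using t(3) by (auto simp: deg_def)
  qed (use assms in auto)
  then show ?thesis
    using v by (simp add: fun_ptr_def)
qed

lemma base_loop:
  assumes inp: "input (snd s)" and size: "fst s Size = int n" and i: "i < n"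
    and row: "fst s Row = int (2 + i * n)" and "fst s Base = 0"
  shows "fst (den (For Loop2 (Cond (Var Loop2 [-] Num (int r - 1))
          (Base ::= Var Base [+] Mem (Var Row [+] Var Loop2)) Pass)) s) Base = int (base True i)"
    (is "fst (den (For Loop2 ?c) s) Base = _")
proof -
  let ?P = "\<lambda>k t. fst t Base = int (card {j. j < k \<and> r \<le> j \<and> adj i j})"
  have "?P n (den (For Loop2 ?c) s)"
  proof (rule den_For_invariant[where P = ?P])
    fix k and t :: store
    assume k: "k < n" and P: "?P k t" and loop: "fst t Loop2 = int k"
      and fr: "\<And>y. y \<notin> insert Loop2 (written ?c) \<Longrightarrow> fst t y = fst s y"
      and sil: "silent ?c \<Longrightarrow> snd t = snd s"
    have "snd t (fst t Row + int k) = of_bool (adj i k)"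
      using input_adj[OF inp i k] row fr[of Row] sil by simp
    then show "?P (Suc k) (set_var Loop2 (int k + 1) (den ?c t))"
      using P loop by (auto simp: card_less_Suc_filter)
  qed (use assms in auto)
  then show ?thesis
    by (simp add: base_def conj_ac)
qed

lemma prepare_correct:
  assumes "config b s" "fst s Vertex = int i" "i < n"
  shows "ready b i (den (prepare r) s)"
proof -
  have c: "fst s Size = int n" "fst s Mode = of_bool b" "\<And>j. j < r \<Longrightarrow> fst s (Power j) = int (n ^ j)"
    "fst s LayerSize = int (n ^ r)" "input (snd s)"
    using assms(1) by (auto simp: config_def)
  let ?row = "Row ::= Num 2 ;; For Loop2 (Row ::= Var Row [+] Var Vertex)"
  let ?ptr = "FunPtr ::= Num 2 [+] Var Vertex ;; Ptr ::= Num 2 ;;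
      For Loop2 (For Loop3 (
        FunPtr ::= Var FunPtr [+] Num 1 ;;
        Cond (Var Vertex [-] Var Loop2) (FunPtr ::= Var FunPtr [+] Mem (Var Ptr)) Pass ;;
        Ptr ::= Var Ptr [+] Num 1))"
  let ?base = "Base ::= Num 0 ;;
      Cond (Var Mode)
        (For Loop2 (Cond (Var Loop2 [-] Num (int r - 1))
          (Base ::= Var Base [+] Mem (Var Row [+] Var Loop2)) Pass)) Pass"
  let ?w = "\<lambda>j. Cond (Var Vertex [-] Num (int j - 1))
        (Cond (Num (int j + 1) [-] Var Vertex) (Weight ::= Var (Power j)) Pass) Pass"
  define s1 where "s1 = den ?row s"
  define s2 where "s2 = den ?ptr s1"
  define s3 where "s3 = den ?base s2"
  define s4 where "s4 = den (Weight ::= Num 0 ;; each ?w [0..<r]) s3"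
  have "fst s1 Row = int (2 + i * n)"
    using c(1) assms(2) multiple_loop[of Loop2 Row Vertex "set_var Row 2 s" n]
    by (simp add: s1_def algebra_simps)
  moreover have s1: "snd s1 = snd s" "\<And>y. y \<notin> {Row, Loop2} \<Longrightarrow> fst s1 y = fst s y"
    by (simp_all add: s1_def)
  moreover have "fst s2 FunPtr = int (fun_ptr i)"
    unfolding s2_def den.simps(1-5) by (rule fun_ptr_loop) (use c s1 assms in auto)
  moreover have s2: "snd s2 = snd s1" "\<And>y. y \<notin> {FunPtr, Ptr, Loop2, Loop3} \<Longrightarrow> fst s2 y = fst s1 y"
    by (simp_all add: s2_def)
  moreover have "fst s3 Base = int (base b i)"
  proof (cases b)
    case True
    then show ?thesis
      unfolding s3_def using base_loop[of "set_var Base 0 s2" i] c s1 s2 assms calculation(1)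
      by (simp add: multiple_loop)
  next
    case False
    then show ?thesis
      using c(2) s1(2)[of Mode] s2(2)[of Mode] by (simp add: s3_def base_def)
  qed
  moreover have s3: "snd s3 = snd s2" "\<And>y. y \<notin> {Base, Loop2} \<Longrightarrow> fst s3 y = fst s2 y"
    by (simp_all add: s3_def)
  moreover have "fst s4 Weight = int (weight i)"
  proof -
    have "fst (den (each ?w [0..<r]) (set_var Weight 0 s3)) Weight = (if i < r then int (n ^ i) else 0)"
    proof (rule den_each_upt_invariant[where P = "\<lambda>m t. fst t Weight = (if i < m then int (n ^ i) else 0)"])
      fix j and t :: store
      assume "j < r" "fst t Weight = (if i < j then int (n ^ i) else 0)"
        and fr: "\<And>y. \<forall>j<r. y \<notin> written (?w j) \<Longrightarrow> fst t y = fst (set_var Weight 0 s3) y"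
      moreover have "fst t Vertex = int i" "fst t (Power j) = int (n ^ j)"
        using fr[of Vertex] fr[of "Power j"] assms(2) c(3)[OF \<open>j < r\<close>] s1 s2 s3 by auto
      ultimately show "fst (den (?w j) t) Weight = (if i < Suc j then int (n ^ i) else 0)"
        by (auto simp: less_Suc_eq)
    qed simp
    then show ?thesis
      by (simp add: s4_def weight_def)
  qed
  moreover have s4: "snd s4 = snd s3" "\<And>y. y \<noteq> Weight \<Longrightarrow> fst s4 y = fst s3 y"
    by (simp_all add: s4_def)
  ultimately have "ready b i s4"
    using c assms by (simp add: ready_def config_def)
  moreover have "den (prepare r) s = s4"
    by (simp add: prepare_def s1_def s2_def s3_def s4_def)
  ultimately show ?thesis by simp
qed

lemma ready_preserved:
  assumes "ready b i s" "silent c"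
    and "written c \<inter> ({Size, Mode, Vertex, Row, FunPtr, Base, Weight, LayerSize} \<union> range Power) = {}"
  shows "ready b i (den c s)"
proof -
  have "fst (den c s) y = fst s y" if "y \<in> {Size, Mode, Vertex, Row, FunPtr, Base, Weight, LayerSize} \<union> range Power" for y
    using assms(3) that by (intro den_unwritten) blast
  then show ?thesis
    using assms(1,2) by (simp add: ready_def config_def)
qed

lemma evaluate_legal:
  assumes "ready b i s" "i < n" "set A \<subseteq> {..<r}"
  shows "fst (den (evaluate r A) s) Legal = of_bool (legal i (set A))"
proof -
  let ?c = "\<lambda>j. Cond (Var Vertex [-] Num (int j))
        (Cond (Mem (Var Row [+] Num (int j))) Pass (Legal ::= Num 0)) (Legal ::= Num 0)"
  have "fst (den (each ?c A) (set_var Legal 1 s)) Legal = of_bool (legal i (set A))"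
  proof (rule den_each_invariant[where P = "\<lambda>ys t. fst t Legal = of_bool (legal i (set ys))"])
    fix ys x zs and t :: store
    assume A: "A = ys @ x # zs" and P: "fst t Legal = of_bool (legal i (set ys))"
      and fr: "\<And>y. \<forall>x\<in>set A. y \<notin> written (?c x) \<Longrightarrow> fst t y = fst (set_var Legal 1 s) y"
      and sil: "\<forall>x\<in>set A. silent (?c x) \<Longrightarrow> snd t = snd (set_var Legal 1 s)"
    have x: "x < r" "x < n"
      using A assms(3) r_le by auto
    have "fst t Vertex = int i" "fst t Row = 2 + int i * int n" "input (snd t)"
      using fr[of Vertex] fr[of Row] sil assms(1) by (auto simp: ready_def config_def)
    moreover from this(3) have "snd t (2 + int i * int n + int x) = of_bool (adj i x)"
      using assms(2) x(2) by (rule input_adj)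
    ultimately show "fst (den (?c x) t) Legal = of_bool (legal i (set (ys @ [x])))"
      using P x by (auto simp: legal_def)
  qed (simp add: legal_def)
  then show ?thesis
    by (simp add: evaluate_def evaluate_parts) (simp add: check_legal_def)
qed

lemma evaluate_shift:
  assumes "ready b i s" "set A \<subseteq> {..<r}" "distinct A"
  shows "fst (den (evaluate r A) s) Shift = int (shift i (set A))"
proof -
  let ?c = "\<lambda>j. Shift ::= Var Shift [+] (Var (Power j) [+] Var Weight)"
  have "fst (den (each ?c A) (set_var Shift 0 s)) Shift = int (shift i (set A))"
    if "ready b i s" for s
  proof (rule den_each_invariant[where P = "\<lambda>ys t. fst t Shift = int (shift i (set ys))"])
    fix ys x zs and t :: store
    assume A: "A = ys @ x # zs" and P: "fst t Shift = int (shift i (set ys))"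
      and fr: "\<And>y. \<forall>x\<in>set A. y \<notin> written (?c x) \<Longrightarrow> fst t y = fst (set_var Shift 0 s) y"
    have x: "x < r" "x \<notin> set ys"
      using A assms by auto
    have "fst t Weight = int (weight i)" "fst t (Power x) = int (n ^ x)"
      using fr[of Weight] fr[of "Power x"] that x by (auto simp: ready_def config_def)
    then show "fst (den (?c x) t) Shift = int (shift i (set (ys @ [x])))"
      using P x by (simp add: shift_def)
  qed (simp add: shift_def)
  from this[OF ready_preserved[OF assms(1), of "check_legal A"]] show ?thesis
    by (simp add: evaluate_def evaluate_parts) (simp add: compute_shift_def)
qed

text \<open>
  The value of choosing \<open>A\<close> at vertex \<open>i\<close>, according to the table in memory.
\<close>

definition candidate :: "bool \<Rightarrow> nat \<Rightarrow> store \<Rightarrow> nat set \<Rightarrow> int" where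
  "candidate b i s A = cost b i A + snd s (- 1 - (fst s Pos - int (n ^ r) + int (shift i A)))"

lemma candidate_cong: "fst t Pos = fst s Pos \<Longrightarrow> snd t = snd s \<Longrightarrow> candidate b i t A = candidate b i s A"
  by (simp add: candidate_def)

lemma evaluate_value:
  assumes "ready b i s" "i < n" "set A \<subseteq> {..<r}" "distinct A" "legal i (set A)"
  shows "fst (den (evaluate r A) s) Val = candidate b i s (set A)"
proof -
  define t where "t = den (compute_shift A) (den (check_legal A) s)"
  have ev: "den (evaluate r A) s = den (compute_value r A) t"
    by (simp add: evaluate_def t_def)
  have t: "ready b i t" "snd t = snd s" "fst t Pos = fst s Pos"
    using assms(1) by (auto simp: t_def evaluate_parts intro!: ready_preserved)
  have "fst t Shift = int (shift i (set A))"
    using evaluate_shift[OF assms(1,3,4)] by (simp add: ev evaluate_parts)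
  moreover have "snd t (int (fun_ptr i) + int (base b i + card (set A))) = f i (base b i + card (set A))"
    using t(1) assms(2) base_le_deg[OF assms(5,2)] by (intro input_fun) (auto simp: ready_def config_def)
  ultimately show ?thesis
    using t assms(4) by (auto simp: ev compute_value_def ready_def config_def candidate_def cost_def
        distinct_card add.assoc)
qed

lemma accept_chosen: "j < r \<Longrightarrow> fst (den (accept r A) s) (Chosen j) = of_bool (j \<in> set A)"
proof -
  have "\<forall>j<r. fst (den (each (\<lambda>j. Chosen j ::= Num (of_bool (j \<in> set A))) [0..<r]) t) (Chosen j) = of_bool (j \<in> set A)" for t
    by (rule den_each_upt_invariant[where P = "\<lambda>m t. \<forall>j<m. fst t (Chosen j) = of_bool (j \<in> set A)"])
       (auto simp: less_Suc_eq)
  then show "j < r \<Longrightarrow> ?thesis"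
    by (simp add: accept_def)
qed

lemma accept_best:
  "fst (den (accept r A) s) Best = fst s Val" "fst (den (accept r A) s) BestShift = fst s Shift"
  by (simp_all add: accept_def)

definition selected :: "bool \<Rightarrow> nat \<Rightarrow> store \<Rightarrow> nat set \<Rightarrow> bool" where
  "selected b i t A \<longleftrightarrow> legal i A \<and> fst t BestShift = int (shift i A) \<and>
     (\<forall>j<r. fst t (Chosen j) = of_bool (j \<in> A)) \<and> fst t Best = candidate b i t A"

lemma evaluate_accept:
  assumes "ready b i s" "i < n" "set A \<subseteq> {..<r}" "distinct A" "legal i (set A)"
  shows "selected b i (den (accept r A) (den (evaluate r A) s)) (set A)"
  using assms evaluate_value[OF assms] evaluate_shift[OF assms(1,3,4)]
  by (simp add: selected_def accept_chosen accept_best candidate_def)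

text \<open>
  The invariant over the list of subsets: the registers describe some legal choice that is at least
  as good as all legal ones seen so far.
\<close>

lemma best_choice_correct:
  assumes "ready b i s" "i < n"
  defines "t \<equiv> den (best_choice r) s"
  shows "\<exists>A. selected b i t A \<and> (\<forall>B. legal i B \<longrightarrow> candidate b i s A \<le> candidate b i s B)"
proof -
  let ?c = "\<lambda>A. evaluate r A ;; Cond (Var Legal) (Cond (Var Best [-] Var Val) (accept r A) Pass) Pass"
  let ?P = "\<lambda>ys t. ready b i t \<and> (\<exists>A. selected b i t A \<and>
    (\<forall>B\<in>set ys. legal i (set B) \<longrightarrow> candidate b i s A \<le> candidate b i s (set B)))"
  define s0 where "s0 = den (evaluate r [] ;; accept r []) s"
  have s0: "fst s0 Pos = fst s Pos" "snd s0 = snd s"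
    by (auto simp: s0_def)
  have "?P (subseqs [0..<r]) (den (each ?c (subseqs [0..<r])) s0)"
  proof (rule den_each_invariant[where P = ?P])
    have "ready b i s0"
      unfolding s0_def by (rule ready_preserved) (use assms(1) in auto)
    then show "?P [] s0"
      using evaluate_accept[OF assms(1,2), of "[]"] legal_empty by (auto simp: s0_def)
  next
    fix ys A zs and u :: store
    assume sub: "subseqs [0..<r] = ys @ A # zs" and P: "?P ys u"
      and fr: "\<And>y. \<forall>x\<in>set (subseqs [0..<r]). y \<notin> written (?c x) \<Longrightarrow> fst u y = fst s0 y"
      and sil: "\<forall>x\<in>set (subseqs [0..<r]). silent (?c x) \<Longrightarrow> snd u = snd s0"
    have A: "set A \<subseteq> {..<r}" "distinct A"
    proof -
      have "A \<in> set (subseqs [0..<r])"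
        by (simp add: sub)
      then show "distinct A"
        by (rule subseqs_distinctD) simp
      have "set A \<in> Pow (set [0..<r])"
        unfolding subseqs_powset[symmetric] using \<open>A \<in> set (subseqs [0..<r])\<close> by (rule imageI)
      then show "set A \<subseteq> {..<r}"
        by auto
    qed
    have u: "fst u Pos = fst s Pos" "snd u = snd s"
      using fr[of Pos] sil s0 by auto
    have cand: "candidate b i w B = candidate b i s B" if "w \<in> {u, den (evaluate r A) u, den (?c A) u}" for w B
      using that u by (auto intro!: candidate_cong)
    obtain A0 where A0: "selected b i u A0"
      "\<forall>B\<in>set ys. legal i (set B) \<longrightarrow> candidate b i s A0 \<le> candidate b i s (set B)"
      using P by blast
    have ru: "ready b i u"
      using P by blast
    have "ready b i (den (?c A) u)"
      by (rule ready_preserved[OF ru]) auto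
    moreover have "\<exists>A'. selected b i (den (?c A) u) A' \<and>
      (\<forall>B\<in>set (ys @ [A]). legal i (set B) \<longrightarrow> candidate b i s A' \<le> candidate b i s (set B))"
    proof (cases "legal i (set A) \<and> candidate b i s (set A) < candidate b i s A0")
      case True
      then have "den (?c A) u = den (accept r A) (den (evaluate r A) u)"
        using evaluate_legal[OF ru assms(2) A(1)] evaluate_value[OF ru assms(2) A] A0(1)
          cand[of u] by (simp add: selected_def)
      then show ?thesis
        using True A0(2) evaluate_accept[OF ru assms(2) A]
        by (intro exI[of _ "set A"]) force
    next
      case False
      then have "den (?c A) u = den (evaluate r A) u"
        using evaluate_legal[OF ru assms(2) A(1)] evaluate_value[OF ru assms(2) A] A0(1)
          cand[of u] by (auto simp: selected_def)
      moreover have "selected b i (den (evaluate r A) u) A0"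
        using A0(1) by (simp add: selected_def candidate_def)
      ultimately show ?thesis
        using False A0(2) by (intro exI[of _ A0]) auto
    qed
    ultimately show "?P (ys @ [A]) (den (?c A) u)" by blast
  qed
  moreover have "t = den (each ?c (subseqs [0..<r])) s0"
    by (simp add: t_def s0_def best_choice_def)
  ultimately obtain A where A: "selected b i t A"
    "\<forall>B\<in>set (subseqs [0..<r]). legal i (set B) \<longrightarrow> candidate b i s A \<le> candidate b i s (set B)"
    by blast
  have "candidate b i s A \<le> candidate b i s B" if "legal i B" for B
  proof -
    have "B \<in> Pow (set [0..<r])"
      using that by (auto simp: legal_def)
    then show ?thesis
      using A(2) that unfolding subseqs_powset[symmetric] by blast
  qed
  then show ?thesis
    using A(1) by blast
qed

end

section \<open>Filling the tables\<close>

lemma written_emit [simp]: "written (emit x) = {Pos}"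
  by (simp add: emit_def)

lemma well_formed_emit [simp]: "well_formed (emit x)"
  by (simp add: emit_def)

lemma written_compute_terminal [simp]:
  "0 < r \<Longrightarrow> written (compute_terminal r) = {Acc, Vertex, Row, FunPtr, Ptr, Base, Weight, Loop2, Loop3}"
  by (auto simp: compute_terminal_def)

lemma silent_compute_terminal [simp]: "silent (compute_terminal r)"
  by (simp add: compute_terminal_def)

lemma well_formed_compute_terminal [simp]: "well_formed (compute_terminal r)"
  by (simp add: compute_terminal_def)

lemma den_emit: "den (emit x) s = set_var Pos (fst s Pos + 1) (fst s, (snd s)(- 1 - fst s Pos := fst s x))"
  by (simp add: emit_def)

context degree_problem
begin

lemma input_cong: "(\<And>p. 0 \<le> p \<Longrightarrow> M' p = M p) \<Longrightarrow> input M \<Longrightarrow> input M'"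
  by (simp add: input_def)

lemma config_preserved:
  assumes "config b s" "silent c" "written c \<inter> ({Size, Mode, LayerSize} \<union> range Power) = {}"
  shows "config b (den c s)"
proof -
  have "fst (den c s) y = fst s y" if "y \<in> {Size, Mode, LayerSize} \<union> range Power" for y
    using assms(3) that by (intro den_unwritten) blast
  then show ?thesis
    using assms(1,2) by (simp add: config_def)
qed

lemma config_emit: "config b s \<Longrightarrow> 0 \<le> fst s Pos \<Longrightarrow> config b (den (emit x) s)"
  by (auto simp: den_emit config_def elim!: input_cong[rotated])

lemma ready_emit: "ready b i s \<Longrightarrow> 0 \<le> fst s Pos \<Longrightarrow> ready b i (den (emit x) s)"
  using config_emit[of b s x] by (simp add: ready_def den_emit)

lemma compute_terminal_correct:
  assumes c: "config b s" and dig: "\<And>j. j < r \<Longrightarrow> fst s (Digit j) = int (a div n ^ j mod n)"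
    and a: "a \<in> reachable 0"
  shows "fst (den (compute_terminal r) s) Acc = terminal a"
proof -
  let ?c = "\<lambda>j. Vertex ::= Num (int j) ;; prepare r ;;
       Acc ::= Var Acc [+] Mem (Var FunPtr [+] Var (Digit j))"
  let ?P = "\<lambda>m t. config b t \<and> fst t Acc = (\<Sum>j<m. f j (a div n ^ j mod n))"
  have "?P r (den (each ?c [0..<r]) (set_var Acc 0 s))"
  proof (rule den_each_upt_invariant[where P = ?P])
    show "?P 0 (set_var Acc 0 s)"
      using c by (simp add: config_def)
    fix m and t :: store
    assume m: "m < r" and P: "?P m t"
      and fr: "\<And>y. \<forall>j<r. y \<notin> written (?c j) \<Longrightarrow> fst t y = fst (set_var Acc 0 s) y"
    let ?u = "den (prepare r) (set_var Vertex (int m) t)"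
    have ready: "ready b m ?u"
      using P m r_le by (intro prepare_correct) (auto simp: config_def)
    have "fst ?u (Digit m) = int (a div n ^ m mod n)"
      using fr[of "Digit m"] dig[OF m] by simp
    moreover have "snd ?u (int (fun_ptr m) + int (a div n ^ m mod n)) = f m (a div n ^ m mod n)"
      using ready m r_le reachable_digit[OF a m] by (intro input_fun) (auto simp: ready_def config_def)
    ultimately have "fst (den (?c m) t) Acc = (\<Sum>j<Suc m. f j (a div n ^ j mod n))"
      using P ready by (simp add: ready_def)
    moreover have "config b (den (?c m) t)"
      using P by (intro config_preserved) auto
    ultimately show "?P (Suc m) (den (?c m) t)" by blast
  qed
  then show ?thesis
    by (simp add: compute_terminal_def terminal_def)
qed

text \<open>
  The first \<open>k\<close> layers are correct. Nothing is claimed about unreachable codes.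
\<close>

definition layers :: "bool \<Rightarrow> nat \<Rightarrow> (int \<Rightarrow> int) \<Rightarrow> bool" where
  "layers b k M \<longleftrightarrow> (\<forall>x<k. \<forall>c\<in>reachable x. M (- 1 - int (x * n ^ r + c)) = opt b x c)"

lemma layers_cong:
  assumes "layers b k M" "\<And>p. - int (k * n ^ r) \<le> p \<Longrightarrow> p < 0 \<Longrightarrow> M' p = M p"
  shows "layers b k M'"
proof -
  have "M' (- 1 - int (x * n ^ r + c)) = M (- 1 - int (x * n ^ r + c))" if "x < k" "c \<in> reachable x" for x c
  proof -
    have "x * n ^ r + c < (x + 1) * n ^ r"
      using reachable_less[OF that(2)] by simp
    also have "\<dots> \<le> k * n ^ r"
      using that(1) by (intro mult_le_mono1) simp
    finally have "int (x * n ^ r + c) < int (k * n ^ r)"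
      by (simp only: of_nat_less_iff)
    then show ?thesis
      by (intro assms(2)) linarith+
  qed
  then show ?thesis
    using assms(1) unfolding layers_def by simp
qed

text \<open>
  Layer 0 and the higher layers are filled by the same loop with different bodies. The predicate \<open>J\<close>
  stands for the context in which the body computes the entry: \<open>config\<close> for layer 0, where the body
  visits several vertices, and \<open>ready\<close> for the others.
\<close>

lemma fill_layer:
  fixes J :: "store \<Rightarrow> bool"
  assumes wf: "well_formed c" "silent c" "Size \<notin> written c" "Pos \<notin> written c" "\<And>j. Digit j \<notin> written c"
    and J: "\<And>t. J t \<Longrightarrow> J (den c t)" "\<And>t. J t \<Longrightarrow> 0 \<le> fst t Pos \<Longrightarrow> J (den (emit y) t)"
      "\<And>t j v. J t \<Longrightarrow> J (set_var (Digit j) v t)"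
    and val: "\<And>a t. a \<in> reachable k \<Longrightarrow> J t \<Longrightarrow> fst t Pos = int (k * n ^ r + a) \<Longrightarrow> layers b k (snd t) \<Longrightarrow>
      (\<And>j. j < r \<Longrightarrow> fst t (Digit j) = int (a div n ^ j mod n)) \<Longrightarrow> fst (den c t) y = opt b k a"
    and s: "J s" "fst s Size = int n" "fst s Pos = int (k * n ^ r)" "layers b k (snd s)"
  defines "t \<equiv> den (nest r (c ;; emit y)) s"
  shows "J t \<and> fst t Pos = int (Suc k * n ^ r) \<and> layers b (Suc k) (snd t) \<and>
    (\<forall>p. 0 \<le> p \<or> p < - int (Suc k * n ^ r) \<longrightarrow> snd t p = snd s p)"
proof -
  let ?P = "\<lambda>a t. J t \<and> fst t Pos = int (k * n ^ r + a) \<and> layers b k (snd t) \<and>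
    (\<forall>d\<in>reachable k. d < a \<longrightarrow> snd t (- 1 - int (k * n ^ r + d)) = opt b k d) \<and>
    (\<forall>p. 0 \<le> p \<or> p < - int (Suc k * n ^ r) \<longrightarrow> snd t p = snd s p)"
  have "?P (n ^ r) t"
    unfolding t_def
  proof (rule den_nest_invariant[where P = ?P])
    fix a and t :: store
    assume a: "a < n ^ r" and P: "?P a t" and dig: "\<And>j. j < r \<Longrightarrow> fst t (Digit j) = int (a div n ^ j mod n)"
    let ?u = "den c t" let ?v = "den (emit y) ?u"
    have u: "fst ?u Pos = int (k * n ^ r + a)" "snd ?u = snd t"
      using P wf by auto
    have v: "snd ?v = (snd t)(- 1 - int (k * n ^ r + a) := fst ?u y)"
      using u by (simp add: den_emit)
    have "J ?v"
      using P J u by simp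
    moreover have "fst ?v Pos = int (k * n ^ r + Suc a)"
      using u by (simp add: den_emit)
    moreover have "layers b k (snd ?v)"
      using P unfolding v by (auto elim!: layers_cong)
    moreover have "snd ?v (- 1 - int (k * n ^ r + d)) = opt b k d" if "d \<in> reachable k" "d < Suc a" for d
    proof (cases "d = a")
      case True
      then show ?thesis
        unfolding v using val[of a t] P dig that by simp
    next
      case False
      then show ?thesis
        unfolding v using P that by simp
    qed
    moreover have "snd ?v p = snd s p" if "0 \<le> p \<or> p < - int (Suc k * n ^ r)" for p
    proof -
      have "k * n ^ r + a < Suc k * n ^ r"
        using a by simp
      then have "int (k * n ^ r + a) < int (Suc k * n ^ r)"
        by (simp only: of_nat_less_iff)
      moreover have "0 \<le> int (k * n ^ r + a)"
        by (rule of_nat_0_le_iff)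
      ultimately have "p \<noteq> - 1 - int (k * n ^ r + a)"
        using that by linarith
      then have "snd ?v p = snd t p"
        unfolding v by (rule fun_upd_other)
      also have "\<dots> = snd s p"
        using P that by blast
      finally show ?thesis .
    qed
    ultimately show "?P (Suc a) (den (c ;; emit y) t)" by simp
  qed (use wf s J(3) in auto)
  then show ?thesis
    by (auto simp: layers_def less_Suc_eq reachable_less add.commute)
qed

definition outside_tables :: "int \<Rightarrow> bool" where
  "outside_tables p \<longleftrightarrow> 0 \<le> p \<or> p < - int (Suc n * n ^ r)"

lemma candidate_layers:
  assumes "layers b (Suc x) (snd t)" "fst t Pos = int (Suc x * n ^ r + a)"
    "a \<in> reachable (Suc x)" "x < n" "legal (n - Suc x) A"
  shows "candidate b (n - Suc x) t A = cost b (n - Suc x) A + opt b x (a + shift (n - Suc x) A)"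
proof -
  have "fst t Pos - int (n ^ r) + int (shift (n - Suc x) A) = int (x * n ^ r + (a + shift (n - Suc x) A))"
    using assms(2) by simp
  moreover have "snd t (- 1 - int (x * n ^ r + (a + shift (n - Suc x) A))) = opt b x (a + shift (n - Suc x) A)"
    using assms(1) reachable_step[OF assms(3-5)] unfolding layers_def by blast
  ultimately show ?thesis
    by (simp only: candidate_def)
qed

text \<open>
  In a correct layer the candidate values are the terms of the minimum that defines \<open>opt\<close>.
\<close>

lemma best_choice_opt:
  assumes "ready b (n - Suc x) t" "layers b (Suc x) (snd t)" "fst t Pos = int (Suc x * n ^ r + a)"
    "a \<in> reachable (Suc x)" "x < n"
  defines "u \<equiv> den (best_choice r) t"
  shows "\<exists>A. selected b (n - Suc x) u A \<and> fst u Best = opt b (Suc x) a \<and>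
    opt b (Suc x) a = cost b (n - Suc x) A + opt b x (a + shift (n - Suc x) A)"
proof -
  let ?i = "n - Suc x"
  obtain A where A: "selected b ?i u A" "\<And>B. legal ?i B \<Longrightarrow> candidate b ?i t A \<le> candidate b ?i t B"
    using best_choice_correct[OF assms(1)] assms(5) unfolding u_def by auto
  have leg: "legal ?i A"
    using A(1) by (simp add: selected_def)
  note cand = candidate_layers[OF assms(2-5)]
  have "opt b (Suc x) a = candidate b ?i t A"
    using A(2) leg finite_Collect_legal by (auto simp: cand intro!: Min_eqI)
  moreover have "fst u Best = candidate b ?i t A"
    using A(1) by (simp add: selected_def candidate_def u_def)
  ultimately show ?thesis
    using A(1) cand[OF leg] by auto
qed

lemma fill_correct:
  assumes "config b s"
  defines "t \<equiv> den (fill r) s"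
  shows "config b t \<and> fst t Pos = int (Suc n * n ^ r) \<and> layers b (Suc n) (snd t) \<and>
    (\<forall>p. outside_tables p \<longrightarrow> snd t p = snd s p)"
proof -
  have r: "0 < r" using r_pos by simp
  define s1 where "s1 = den (nest r (compute_terminal r ;; emit Acc)) (set_var Pos 0 s)"
  have s1: "config b s1 \<and> fst s1 Pos = int (Suc 0 * n ^ r) \<and> layers b (Suc 0) (snd s1) \<and>
    (\<forall>p. 0 \<le> p \<or> p < - int (Suc 0 * n ^ r) \<longrightarrow> snd s1 p = snd (set_var Pos 0 s) p)"
    unfolding s1_def
    by (rule fill_layer)
       (use assms(1) r in \<open>auto simp: compute_terminal_correct config_emit layers_def intro!: config_preserved\<close>, auto simp: config_def)
  let ?c = "Vertex ::= Var Size [-] Num 1 [-] Var Loop0 ;; prepare r ;; nest r (best_choice r ;; emit Best)"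
  let ?P = "\<lambda>k t. config b t \<and> fst t Pos = int (Suc k * n ^ r) \<and> layers b (Suc k) (snd t) \<and>
    (\<forall>p. outside_tables p \<longrightarrow> snd t p = snd s p)"
  have outside: "p < - int (Suc k * n ^ r)" if "p < - int (Suc n * n ^ r)" "k \<le> n" for p k
  proof -
    have "int (Suc k * n ^ r) \<le> int (Suc n * n ^ r)"
      using that(2) unfolding of_nat_le_iff by (intro mult_le_mono1) simp
    then show ?thesis using that(1) by linarith
  qed
  have "?P n (den (For Loop0 ?c) s1)"
  proof (rule den_For_invariant[where P = ?P])
    show "well_formed (For Loop0 ?c)"
      by auto
    show "fst s1 Size = int n"
      using s1 by (simp add: config_def)
    show "?P 0 (set_var Loop0 0 s1)"
      using s1 outside[of _ 0] by (auto simp: config_def outside_tables_def)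
    fix k and t :: store
    assume k: "k < n" and P: "?P k t" and loop: "fst t Loop0 = int k"
    let ?i = "n - Suc k"
    let ?u = "den (prepare r) (set_var Vertex (int ?i) t)"
    let ?v = "den (nest r (best_choice r ;; emit Best)) ?u"
    have i: "int n - 1 - int k = int ?i" "?i < n"
      using k by auto
    have u: "ready b ?i ?u"
      using P i by (intro prepare_correct) (auto simp: config_def)
    have "ready b ?i ?v \<and> fst ?v Pos = int (Suc (Suc k) * n ^ r) \<and> layers b (Suc (Suc k)) (snd ?v) \<and>
      (\<forall>p. 0 \<le> p \<or> p < - int (Suc (Suc k) * n ^ r) \<longrightarrow> snd ?v p = snd ?u p)"
    proof (rule fill_layer)
      show "fst (den (best_choice r) w) Best = opt b (Suc k) a"
        if "a \<in> reachable (Suc k)" "ready b ?i w" "fst w Pos = int (Suc k * n ^ r + a)" "layers b (Suc k) (snd w)" for a w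
        using best_choice_opt[OF that(2,4,3,1) k] by blast
      show "ready b ?i (set_var (Digit j) v w)" if "ready b ?i w" for w j v
        using that by (simp add: ready_def config_def)
    qed (use u P in \<open>auto simp: ready_emit intro!: ready_preserved, auto simp: ready_def config_def\<close>)
    moreover have "den ?c t = ?v"
      using P loop i by (simp add: config_def)
    moreover have "config b (set_var Loop0 (int k + 1) ?v)" if "ready b ?i ?v"
      using that by (simp add: ready_def config_def)
    ultimately show "?P (Suc k) (set_var Loop0 (int k + 1) (den ?c t))"
      using P outside[of _ "Suc k"] k by (auto simp: outside_tables_def)
  qed
  moreover have "t = den (For Loop0 ?c) s1"
    by (simp add: t_def s1_def fill_def)
  ultimately show ?thesis by simp
qed

section \<open>Reading off an optimal subgraph\<close>

lemma powers_correct: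
  assumes "fst s Size = int n"
  defines "t \<equiv> den (powers r) s"
  shows "(\<forall>j<r. fst t (Power j) = int (n ^ j)) \<and> fst t LayerSize = int (n ^ r)"
proof -
  let ?c = "\<lambda>j. Power (Suc j) ::= Num 0 ;;
        For Loop0 (Power (Suc j) ::= Var (Power (Suc j)) [+] Var (Power j))"
  let ?P = "\<lambda>m t. \<forall>j\<le>m. fst t (Power j) = int (n ^ j)"
  have "?P r (den (each ?c [0..<r]) (set_var (Power 0) 1 s))"
  proof (rule den_each_upt_invariant[where P = ?P])
    fix m and t :: store
    assume m: "m < r" and P: "?P m t"
      and fr: "\<And>y. \<forall>j<r. y \<notin> written (?c j) \<Longrightarrow> fst t y = fst (set_var (Power 0) 1 s) y"
    have "fst (den (?c m) t) (Power (Suc m)) = int (n ^ Suc m)"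
      using P fr[of Size] assms(1) by (simp add: multiple_loop[where n = n])
    moreover have "fst (den (?c m) t) (Power j) = fst t (Power j)" if "j \<le> m" for j
      using that by simp
    ultimately show "?P (Suc m) (den (?c m) t)"
      using P by (auto simp: le_Suc_eq)
  qed simp
  then show ?thesis
    by (simp add: t_def powers_def)
qed

text \<open>
  The record of the subgraph starts right behind the \<open>n + 1\<close> layers.
\<close>

definition slot :: "nat \<Rightarrow> nat \<Rightarrow> int" where
  "slot i j = - 1 - int (Suc n * n ^ r + (i * n + j))"

lemma slot_eq_iff: "j < n \<Longrightarrow> j' < n \<Longrightarrow> slot i j = slot i' j' \<longleftrightarrow> i = i' \<and> j = j'"
proof -
  assume "j < n" "j' < n"
  then have "(i * n + j) div n = i" "(i * n + j) mod n = j" "(i' * n + j') div n = i'" "(i' * n + j') mod n = j'"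
    by simp_all
  moreover have "slot i j = slot i' j' \<longleftrightarrow> i * n + j = i' * n + j'"
    unfolding slot_def by (simp del: of_nat_add of_nat_mult)
  ultimately show ?thesis
    by metis
qed

lemma slot_less: "slot i j < - int (Suc n * n ^ r)"
proof -
  have "int (Suc n * n ^ r) \<le> int (Suc n * n ^ r + (i * n + j))"
    unfolding of_nat_le_iff by (rule le_add1)
  then show ?thesis
    unfolding slot_def by linarith
qed

lemma slot_negative: "slot i j < 0"
  unfolding slot_def by (simp del: of_nat_add of_nat_mult)

lemma written_write_row [simp]: "written (write_row r) = {Loop1}"
  by (auto simp: write_row_def)

lemma write_row_correct:
  assumes ready: "ready b i s" and i: "i < n" and out: "fst s Out = int (Suc n * n ^ r)"
    and ch: "\<And>j. j < r \<Longrightarrow> fst s (Chosen j) = of_bool (j \<in> A)" and leg: "legal i A"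
    and zero: "\<And>j. j < n \<Longrightarrow> snd s (slot i j) = 0"
  defines "t \<equiv> den (write_row r) s"
  shows "(\<forall>j<n. snd t (slot i j) = of_bool (j \<in> A \<or> b \<and> r \<le> j \<and> j < i \<and> adj i j)) \<and>
    (\<forall>p. (\<forall>j<n. p \<noteq> slot i j) \<longrightarrow> snd t p = snd s p)"
proof -
  have addr: "1 - (fst s Out + fst s Row + int j) = slot i j" for j
    using ready out by (simp add: ready_def slot_def)
  let ?c = "\<lambda>j. Write (Num 1 [-] (Var Out [+] Var Row [+] Num (int j))) (Var (Chosen j))"
  let ?P = "\<lambda>m t. fst t = fst s \<and> (\<forall>j<n. snd t (slot i j) = of_bool (j < m \<and> j \<in> A)) \<and>
    (\<forall>p. (\<forall>j<n. p \<noteq> slot i j) \<longrightarrow> snd t p = snd s p)"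
  define s1 where "s1 = den (each ?c [0..<r]) s"
  have "?P r s1"
    unfolding s1_def
  proof (rule den_each_upt_invariant[where P = ?P])
    fix m and t :: store
    assume m: "m < r" and P: "?P m t"
    then have mn: "m < n" using r_le by simp
    have "den (?c m) t = (fst s, (snd t)(slot i m := of_bool (m \<in> A)))"
      using P ch[OF m] by (simp add: addr)
    then show "?P (Suc m) (den (?c m) t)"
      using P mn by (auto simp: slot_eq_iff less_Suc_eq)
  qed (simp add: zero)
  then have s1: "fst s1 = fst s" "\<And>j. j < n \<Longrightarrow> snd s1 (slot i j) = of_bool (j \<in> A)"
    "\<And>p. \<forall>j<n. p \<noteq> slot i j \<Longrightarrow> snd s1 p = snd s p"
    using leg by (auto simp: legal_def)
  show ?thesis
  proof (cases b)
    case False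
    then have "t = s1"
      using s1(1) ready by (simp add: t_def write_row_def s1_def[symmetric] ready_def config_def)
    then show ?thesis
      using s1 False by simp
  next
    case True
    let ?d = "Cond (Var Vertex [-] Var Loop1) (Cond (Var Loop1 [-] Num (int r - 1))
         (Write (Num 1 [-] (Var Out [+] Var Row [+] Var Loop1)) (Mem (Var Row [+] Var Loop1)))
         Pass) Pass"
    let ?Q = "\<lambda>m t. (\<forall>j<n. snd t (slot i j) = of_bool (j \<in> A \<or> j < m \<and> r \<le> j \<and> j < i \<and> adj i j)) \<and>
      (\<forall>p. (\<forall>j<n. p \<noteq> slot i j) \<longrightarrow> snd t p = snd s p)"
    have "?Q n (den (For Loop1 ?d) s1)"
    proof (rule den_For_invariant[where P = ?Q])
      fix m and u :: store
      assume m: "m < n" and Q: "?Q m u" and loop: "fst u Loop1 = int m"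
        and fr: "\<And>y. y \<notin> insert Loop1 (written ?d) \<Longrightarrow> fst u y = fst s1 y"
      have u: "fst u Vertex = int i" "fst u Row = 2 + int i * int n" "fst u Out = fst s Out" "fst u Row = fst s Row"
        using fr[of Vertex] fr[of Row] fr[of Out] ready by (auto simp: s1 ready_def)
      have "input (snd u)"
      proof (rule input_cong)
        show "input (snd s)"
          using ready by (simp add: ready_def config_def)
        fix p :: int
        assume "0 \<le> p"
        then have "\<forall>j<n. p \<noteq> slot i j"
          using slot_negative by (auto simp: not_less[symmetric])
        then show "snd u p = snd s p"
          using Q by blast
      qed
      then have adj: "snd u (fst u Row + int m) = of_bool (adj i m)"
        using input_adj[OF _ i m] u(2) by simp
      have "den ?d u = (if r \<le> m \<and> m < i then (fst u, (snd u)(slot i m := of_bool (adj i m))) else u)"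
        using u loop adj by (simp add: addr) (simp add: addr[of m, symmetric] u)
      then show "?Q (Suc m) (set_var Loop1 (int m + 1) (den ?d u))"
        using Q m leg by (auto simp: slot_eq_iff less_Suc_eq legal_def)
    qed (use s1 ready in \<open>auto simp: ready_def config_def\<close>)
    moreover have "t = den (For Loop1 ?d) s1"
      using True s1(1) ready by (simp add: t_def write_row_def s1_def[symmetric] ready_def config_def)
    ultimately have Q: "?Q n t" by simp
    then have "snd t (slot i j) = of_bool (j \<in> A \<or> b \<and> r \<le> j \<and> j < i \<and> adj i j)" if "j < n" for j
      using that True by simp
    then show ?thesis
      using Q by blast
  qed
qed

lemma zero_reachable: "0 \<in> reachable n"
proof -
  have "legal_choice (\<lambda>_. {})"
    by (simp add: legal_choice_def legal_empty)
  then show ?thesis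
    unfolding reachable_def by (auto simp: code_def intro!: exI[of _ "\<lambda>_. {}"])
qed

lemma code_reachable: "legal_choice \<alpha> \<Longrightarrow> k \<le> n \<Longrightarrow> code \<alpha> k \<in> reachable (n - k)"
  unfolding reachable_def by (auto intro!: exI[of _ \<alpha>])

text \<open>
  The cells read are negative and the cells written are positive, so the order of writing is
  immaterial; it is row by row, and \<open>q\<close> below is the position in this order.
\<close>

lemma print_graph_correct:
  assumes size: "fst s Size = int n" and out: "fst s Out = int (Suc n * n ^ r)"
  defines "t \<equiv> den print_graph s"
  shows "snd t 0 = int (n * n)"
    and "\<lbrakk>i < n; j < n\<rbrakk> \<Longrightarrow> snd t (int (Suc (i * n + j))) = snd s (slot i j) + snd s (slot j i)"
proof -
  let ?acc = "For Loop2 (Acc ::= Var Acc [+] Var Loop1)"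
  let ?w = "Write (Var Ptr) (Mem (Num 0 [-] (Var Out [+] Var Ptr)) [+] Mem (Num (-1) [-] (Var Out [+] Var Acc)))"
  let ?c = "Acc ::= Var Loop0 ;; ?acc ;; ?w ;; Ptr ::= Var Ptr [+] Num 1"
  let ?G = "\<lambda>q. snd s (slot (q div n) (q mod n)) + snd s (slot (q mod n) (q div n))"
  let ?P = "\<lambda>m t. fst t Ptr = int (Suc m) \<and> (\<forall>p<0. snd t p = snd s p) \<and>
    (\<forall>q<m. snd t (int (Suc q)) = ?G q)"
  have step: "?P (Suc q) w"
    if "?P q u" "fst w Ptr = int (Suc q) + 1" "snd w = (snd u)(int (Suc q) := ?G q)" for q u w
    using that by (auto simp: less_Suc_eq)
  define s1 where "s1 = den (For Loop0 (For Loop1 ?c)) (set_var Ptr 1 s)"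
  have "?P (n * n) s1"
    unfolding s1_def
  proof (rule den_For_invariant[where P = "\<lambda>k. ?P (k * n)"])
    fix k and t :: store
    assume k: "k < n" and P: "?P (k * n) t" and loop0: "fst t Loop0 = int k"
      and fr: "\<And>y. y \<notin> insert Loop0 (written (For Loop1 ?c)) \<Longrightarrow> fst t y = fst (set_var Ptr 1 s) y"
    have t: "fst t Size = int n" "fst t Out = fst s Out"
      using fr[of Size] fr[of Out] size by auto
    have "?P (k * n + n) (den (For Loop1 ?c) t)"
    proof (rule den_For_invariant[where P = "\<lambda>m. ?P (k * n + m)"])
      fix m and u :: store
      assume m: "m < n" and Q: "?P (k * n + m) u" and loop1: "fst u Loop1 = int m"
        and fru: "\<And>y. y \<notin> insert Loop1 (written ?c) \<Longrightarrow> fst u y = fst t y"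
      have u: "fst u Size = int n" "fst u Out = fst s Out" "fst u Loop0 = int k"
        using fru[of Size] fru[of Out] fru[of Loop0] t loop0 by auto
      define v where "v = den ?acc (set_var Acc (int k) u)"
      have v: "fst v Acc = int (m * n + k)" "fst v Ptr = int (Suc (k * n + m))" "fst v Out = fst s Out" "snd v = snd u"
        using u loop1 Q by (simp_all add: v_def multiple_loop[where n = n])
      have a1: "0 - (fst v Out + fst v Ptr) = slot k m" and a2: "- 1 - (fst v Out + fst v Acc) = slot m k"
        using v out by (simp_all add: slot_def)
      have "(k * n + m) div n = k" "(k * n + m) mod n = m"
        using m by simp_all
      then have G: "snd u (slot k m) + snd u (slot m k) = ?G (k * n + m)"
        using Q slot_negative by simp
      have "den ?c u = set_var Ptr (fst v Ptr + 1) (fst v, (snd u)(fst v Ptr := ?G (k * n + m)))"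
      proof -
        have "den ?c u = den (?w ;; Ptr ::= Var Ptr [+] Num 1) v"
          using u(3) by (simp add: v_def)
        also have "\<dots> = set_var Ptr (fst v Ptr + 1)
            (fst v, (snd v)(fst v Ptr := snd v (0 - (fst v Out + fst v Ptr)) + snd v (- 1 - (fst v Out + fst v Acc))))"
          by simp
        finally show ?thesis
          unfolding a1 a2 v(4) G .
      qed
      then have "?P (Suc (k * n + m)) (set_var Loop1 (int m + 1) (den ?c u))"
        by (intro step[OF Q]) (simp_all only: v(2), simp_all)
      then show "?P (k * n + Suc m) (set_var Loop1 (int m + 1) (den ?c u))"
        unfolding add_Suc_right .
    qed (use t P in auto)
    then show "?P (Suc k * n) (set_var Loop0 (int k + 1) (den (For Loop1 ?c) t))"
      by (simp add: add.commute)
  qed (use size in auto)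
  moreover have "t = den (Write (Num 0) (Var Ptr [-] Num 1)) s1"
    by (simp add: t_def s1_def print_graph_def)
  ultimately have t: "snd t = (snd s1)(0 := int (n * n))" "\<And>q. q < n * n \<Longrightarrow> snd s1 (int (Suc q)) = ?G q"
    by simp_all
  then show "snd t 0 = int (n * n)"
    by simp
  assume ij: "i < n" "j < n"
  have "i * n + j < (i + 1) * n"
    using ij by simp
  also have "\<dots> \<le> n * n"
    using ij by (intro mult_le_mono1) simp
  finally have "i * n + j < n * n" .
  then have "snd s1 (int (Suc (i * n + j))) = ?G (i * n + j)"
    by (rule t(2))
  moreover have "snd t (int (Suc (i * n + j))) = snd s1 (int (Suc (i * n + j)))"
    unfolding t(1) by (rule fun_upd_other) (simp only: of_nat_eq_0_iff nat.simps simp_thms)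
  moreover have "(i * n + j) div n = i" "(i * n + j) mod n = j"
    using ij by simp_all
  ultimately show "snd t (int (Suc (i * n + j))) = snd s (slot i j) + snd s (slot j i)"
    by metis
qed

text \<open>
  The hypothesis of \<open>opt_greedy\<close> at vertex \<open>i\<close>.
\<close>

definition greedy :: "bool \<Rightarrow> (nat \<Rightarrow> nat set) \<Rightarrow> nat \<Rightarrow> bool" where
  "greedy b \<alpha> i \<longleftrightarrow>
     opt b (n - i) (code \<alpha> i) = cost b i (\<alpha> i) + opt b (n - Suc i) (code \<alpha> (Suc i))"

lemma code_upd: "k \<le> i \<Longrightarrow> code (\<alpha>(i := A)) k = code \<alpha> k"
  by (auto simp: code_def intro!: sum.cong)

text \<open>
  The invariant of \<open>reconstruct\<close> after \<open>k\<close> vertices. The values of \<open>\<alpha>\<close> from \<open>k\<close> on are legal but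
  otherwise arbitrary; they influence neither \<open>code \<alpha> k\<close> nor the recorded rows.
\<close>

definition reconstructed :: "bool \<Rightarrow> (nat \<Rightarrow> nat set) \<Rightarrow> nat \<Rightarrow> store \<Rightarrow> bool" where
  "reconstructed b \<alpha> k t \<longleftrightarrow> legal_choice \<alpha> \<and> (\<forall>i<k. greedy b \<alpha> i) \<and>
     config b t \<and> fst t Out = int (Suc n * n ^ r) \<and> fst t Pos = int ((n - k) * n ^ r + code \<alpha> k) \<and>
     layers b (Suc n) (snd t) \<and>
     (\<forall>i<n. \<forall>j<n. snd t (slot i j) = of_bool (i < k \<and> j \<in> earlier b \<alpha> i))"

lemma reconstructed_loop_var: "reconstructed b \<alpha> k t \<Longrightarrow> reconstructed b \<alpha> k (set_var Loop0 v t)"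
  by (simp add: reconstructed_def config_def)

lemma reconstruct_step:
  assumes P: "reconstructed b \<alpha> k t" and k: "k < n" and loop: "fst t Loop0 = int k"
  defines "u \<equiv> den (Vertex ::= Var Loop0 ;; prepare r ;; best_choice r ;;
       Pos ::= Var Pos [-] Var LayerSize [+] Var BestShift ;; write_row r) t"
  shows "\<exists>\<beta>. reconstructed b \<beta> (Suc k) u"
proof -
  define u1 where "u1 = den (prepare r) (set_var Vertex (int k) t)"
  define u2 where "u2 = den (best_choice r) u1"
  define u3 where "u3 = set_var Pos (fst u2 Pos - fst u2 LayerSize + fst u2 BestShift) u2"
  have u: "u = den (write_row r) u3"
    by (simp add: u_def u1_def u2_def u3_def loop)
  have P': "legal_choice \<alpha>" "\<And>i. i < k \<Longrightarrow> greedy b \<alpha> i" "config b t" "fst t Out = int (Suc n * n ^ r)"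
    "fst t Pos = int ((n - k) * n ^ r + code \<alpha> k)" "layers b (Suc n) (snd t)"
    "\<And>i j. i < n \<Longrightarrow> j < n \<Longrightarrow> snd t (slot i j) = of_bool (i < k \<and> j \<in> earlier b \<alpha> i)"
    using P by (auto simp: reconstructed_def)
  let ?x = "n - Suc k"
  have x: "Suc ?x = n - k" "n - Suc ?x = k" "?x < n"
    using k by auto
  have u1: "ready b k u1"
    unfolding u1_def using P'(3) k by (intro prepare_correct) (auto simp: config_def)
  have u1': "fst u1 Pos = int ((n - k) * n ^ r + code \<alpha> k)" "snd u1 = snd t" "fst u1 Out = fst t Out"
    using P'(5) by (auto simp: u1_def)
  have lay: "layers b (Suc ?x) (snd u1)"
    using P'(6) by (auto simp: layers_def u1'(2))
  have reach: "code \<alpha> k \<in> reachable (Suc ?x)"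
    using code_reachable[OF P'(1)] k by (simp add: x(1))
  obtain A where A: "selected b k u2 A"
    "opt b (n - k) (code \<alpha> k) = cost b k A + opt b ?x (code \<alpha> k + shift k A)"
    using best_choice_opt[of b ?x u1 "code \<alpha> k"] u1 lay u1'(1) reach x(3)
    unfolding x(2) unfolding x(1) u2_def by blast
  have leg: "legal k A"
    using A(1) by (simp add: selected_def)
  define \<beta> where "\<beta> = \<alpha>(k := A)"
  have code: "code \<beta> i = code \<alpha> i" if "i \<le> k" for i
    using that by (simp add: \<beta>_def code_upd)
  have code_Suc: "code \<beta> (Suc k) = code \<alpha> k + shift k A"
    using code[of k] by (simp add: code_def \<beta>_def)
  have u2: "ready b k u2" "snd u2 = snd t" "fst u2 Pos = fst u1 Pos" "fst u2 Out = fst t Out"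
    "fst u2 LayerSize = int (n ^ r)"
    using ready_preserved[OF u1, of "best_choice r"] u1 u1' unfolding u2_def
    by (auto simp: ready_def config_def)
  have u3: "ready b k u3" "snd u3 = snd t" "fst u3 Out = int (Suc n * n ^ r)"
    using u2 P'(4) by (auto simp: u3_def ready_def config_def)
  have "fst u3 Pos = int ((n - k) * n ^ r + code \<alpha> k) - int (n ^ r) + int (shift k A)"
    using A(1) u2 u1' by (simp add: u3_def selected_def)
  also have "\<dots> = int (?x * n ^ r + code \<beta> (Suc k))"
    unfolding x(1)[symmetric] code_Suc by simp
  finally have pos: "fst u3 Pos = int (?x * n ^ r + code \<beta> (Suc k))" .
  have row: "(\<forall>j<n. snd u (slot k j) = of_bool (j \<in> A \<or> b \<and> r \<le> j \<and> j < k \<and> adj k j)) \<and>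
    (\<forall>p. (\<forall>j<n. p \<noteq> slot k j) \<longrightarrow> snd u p = snd u3 p)"
    unfolding u
  proof (rule write_row_correct[OF u3(1) k u3(3) _ leg])
    show "fst u3 (Chosen j) = of_bool (j \<in> A)" if "j < r" for j
      using A(1) that by (simp add: u3_def selected_def)
    show "snd u3 (slot k j) = 0" if "j < n" for j
      using P'(7)[OF k that] by (simp add: u3(2))
  qed
  have fst_u: "fst u y = fst u3 y" if "y \<noteq> Loop1" for y
    using that by (simp add: u)
  have same: "snd u p = snd t p" if "\<And>j. p \<noteq> slot k j" for p
    using row that u3(2) by simp
  have g1: "legal_choice \<beta>"
    using P'(1) leg by (auto simp: legal_choice_def \<beta>_def)
  have g2: "greedy b \<beta> i" if "i < Suc k" for i
  proof (cases "i = k")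
    case True
    then show ?thesis
      using A(2) code[of k] code_Suc by (simp add: greedy_def \<beta>_def)
  next
    case False
    then show ?thesis
      using P'(2)[of i] that code[of i] code[of "Suc i"] by (simp add: greedy_def \<beta>_def)
  qed
  have g3: "config b u"
  proof -
    have "snd u p = snd t p" if "0 \<le> p" for p
    proof (rule same)
      show "p \<noteq> slot k j" for j
        using that slot_negative[of k j] by linarith
    qed
    then have "input (snd u)"
      using P'(3) input_cong[of "snd u" "snd t"] by (auto simp: config_def)
    then show ?thesis
      using u3(1) by (simp add: config_def ready_def fst_u)
  qed
  have g4: "fst u Out = int (Suc n * n ^ r)"
    using u3(3) fst_u[of Out] by simp
  have g5: "fst u Pos = int ((n - Suc k) * n ^ r + code \<beta> (Suc k))"
    using pos fst_u[of Pos] by simp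
  have g6: "layers b (Suc n) (snd u)"
  proof (rule layers_cong[OF P'(6)], rule same)
    show "p \<noteq> slot k j" if "- int (Suc n * n ^ r) \<le> p" for p j
      using that slot_less[of k j] by linarith
  qed
  have g7: "snd u (slot i j) = of_bool (i < Suc k \<and> j \<in> earlier b \<beta> i)" if "i < n" "j < n" for i j
  proof (cases "i = k")
    case True
    then show ?thesis
      using row that by (auto simp: earlier_def \<beta>_def)
  next
    case False
    then have "snd u (slot i j) = snd t (slot i j)"
      using row that u3(2) by (simp add: slot_eq_iff)
    then show ?thesis
      using P'(7)[OF that] False by (auto simp: earlier_def \<beta>_def less_Suc_eq)
  qed
  have "\<forall>i<Suc k. greedy b \<beta> i"
    using g2 by simp
  moreover have "\<forall>i<n. \<forall>j<n. snd u (slot i j) = of_bool (i < Suc k \<and> j \<in> earlier b \<beta> i)"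
    using g7 by simp
  ultimately have "reconstructed b \<beta> (Suc k) u"
    unfolding reconstructed_def using g1 g3 g4 g5 g6 by (intro conjI)
  then show ?thesis
    by (rule exI[of _ \<beta>])
qed

lemma reconstruct_correct:
  assumes "config b s" "fst s Pos = int (Suc n * n ^ r)" "layers b (Suc n) (snd s)"
    and zero: "\<And>i j. snd s (slot i j) = 0"
  defines "t \<equiv> den (reconstruct r) s"
  shows "\<exists>\<alpha>. legal_choice \<alpha> \<and> opt b n 0 = degree_cost (edge b \<alpha>) \<and> fst t Size = int n \<and>
    fst t Out = int (Suc n * n ^ r) \<and> (\<forall>i<n. \<forall>j<n. snd t (slot i j) = of_bool (j \<in> earlier b \<alpha> i))"
proof -
  let ?c = "Vertex ::= Var Loop0 ;; prepare r ;; best_choice r ;;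
       Pos ::= Var Pos [-] Var LayerSize [+] Var BestShift ;; write_row r"
  define s1 where "s1 = set_var Pos (fst s Pos - fst s LayerSize) (set_var Out (fst s Pos) s)"
  have "reconstructed b (\<lambda>_. {}) 0 s1"
    unfolding reconstructed_def
  proof (intro conjI allI impI)
    show "legal_choice (\<lambda>_. {})"
      by (simp add: legal_choice_def legal_empty)
    show "config b s1"
      using assms(1) by (simp add: s1_def config_def)
    show "fst s1 Out = int (Suc n * n ^ r)"
      using assms(2) by (simp add: s1_def)
    show "fst s1 Pos = int ((n - 0) * n ^ r + code (\<lambda>_. {}) 0)"
      using assms(1,2) by (simp add: s1_def config_def code_def)
    show "layers b (Suc n) (snd s1)"
      using assms(3) by (simp add: s1_def)
  qed (use zero in \<open>simp_all add: s1_def\<close>)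
  then have init: "\<exists>\<alpha>. reconstructed b \<alpha> 0 (set_var Loop0 0 s1)"
    using reconstructed_loop_var by blast
  have "\<exists>\<alpha>. reconstructed b \<alpha> n (den (For Loop0 ?c) s1)"
  proof (rule den_For_invariant[where P = "\<lambda>k t. \<exists>\<alpha>. reconstructed b \<alpha> k t", OF _ _ init])
    show "well_formed (For Loop0 ?c)"
      by (auto simp: write_row_def)
    show "fst s1 Size = int n"
      using assms(1) by (simp add: s1_def config_def)
    show "\<exists>\<alpha>. reconstructed b \<alpha> (Suc k) (set_var Loop0 (int k + 1) (den ?c t))"
      if "k < n" "\<exists>\<alpha>. reconstructed b \<alpha> k t" "fst t Loop0 = int k" for k t
      using reconstruct_step that reconstructed_loop_var by blast
  qed
  moreover have "t = den (For Loop0 ?c) s1"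
    by (simp add: t_def s1_def reconstruct_def)
  ultimately obtain \<alpha> where \<alpha>: "reconstructed b \<alpha> n t"
    by auto
  have leg: "legal_choice \<alpha>"
    using \<alpha> by (simp add: reconstructed_def)
  have "opt b n 0 = (\<Sum>k<n. cost b k (\<alpha> k)) + terminal (code \<alpha> n)"
    by (rule opt_greedy) (use \<alpha> in \<open>simp add: reconstructed_def greedy_def\<close>)
  moreover have "\<forall>i<n. \<forall>j<n. snd t (slot i j) = of_bool (j \<in> earlier b \<alpha> i)"
    using \<alpha> by (simp add: reconstructed_def)
  moreover have "fst t Size = int n" "fst t Out = int (Suc n * n ^ r)"
    using \<alpha> by (simp_all add: reconstructed_def config_def)
  ultimately show ?thesis
    using leg by (auto simp: degree_cost_edge)
qed

end

text \<open>
  Both modes are tried. The tables of the second one are in memory afterwards, so they are computed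
  again only if the first mode was better. A new pass may start on the tables of the previous one,
  because each layer is overwritten before it is read.
\<close>

definition optimize :: "nat \<Rightarrow> prog" where
  "optimize r =
     powers r ;;
     Mode ::= Num 0 ;; fill r ;; Val0 ::= Mem (Num (-1) [-] (Var Pos [-] Var LayerSize)) ;;
     Mode ::= Num 1 ;; fill r ;; Val1 ::= Mem (Num (-1) [-] (Var Pos [-] Var LayerSize)) ;;
     Cond (Var Val1 [-] Var Val0) (Mode ::= Num 0 ;; fill r) Pass ;;
     reconstruct r ;; print_graph"

lemma well_formed_optimize: "well_formed (optimize r)"
  by (auto simp: optimize_def powers_def fill_def reconstruct_def write_row_def print_graph_def compute_terminal_def)

lemma Size_unwritten_optimize: "Size \<notin> written (optimize r)"
  by (auto simp: optimize_def powers_def fill_def reconstruct_def write_row_def print_graph_def compute_terminal_def)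

lemma silent_powers [simp]: "silent (powers r)"
  by (simp add: powers_def)

lemma Val0_unwritten_fill [simp]: "Val0 \<notin> written (fill r)"
  by (auto simp: fill_def compute_terminal_def)

context degree_problem
begin

text \<open>
  The record of the subgraph starts with zeros, which the passes before \<open>reconstruct\<close> do not touch.
\<close>

definition filled :: "bool \<Rightarrow> store \<Rightarrow> bool" where
  "filled b s \<longleftrightarrow> config b s \<and> fst s Pos = int (Suc n * n ^ r) \<and> layers b (Suc n) (snd s) \<and>
     (\<forall>i j. snd s (slot i j) = 0)"

lemma filled_fill:
  assumes "config b s" "\<And>i j. snd s (slot i j) = 0"
  shows "filled b (den (fill r) s)"
proof -
  have "outside_tables (slot i j)" for i j
    using slot_less by (simp add: outside_tables_def)
  then show ?thesis
    using fill_correct[OF assms(1)] assms(2) unfolding filled_def by metis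
qed

lemma filled_value:
  assumes "filled b s"
  shows "snd s (- 1 - (fst s Pos - fst s LayerSize)) = opt b n 0"
proof -
  have "fst s Pos - fst s LayerSize = int (n * n ^ r + 0)"
    using assms by (simp add: filled_def config_def)
  moreover have "snd s (- 1 - int (n * n ^ r + 0)) = opt b n 0"
    using assms zero_reachable unfolding filled_def layers_def by blast
  ultimately show ?thesis
    by (simp only:)
qed

lemma filled_reset: "filled b s \<Longrightarrow> config b' (set_var Mode (of_bool b') (set_var Val0 v s))"
  "filled b s \<Longrightarrow> config b' (set_var Mode (of_bool b') (set_var Val1 v s))"
  "filled b s \<Longrightarrow> filled b (set_var Val1 v s)"
  by (simp_all add: filled_def config_def)

lemma filled_optimum:
  assumes "filled b s"
  defines "t \<equiv> den print_graph (den (reconstruct r) s)"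
  shows "\<exists>\<alpha>. legal_choice \<alpha> \<and> degree_cost (edge b \<alpha>) = opt b n 0 \<and> snd t 0 = int (n * n) \<and>
    (\<forall>i<n. \<forall>j<n. snd t (int (Suc (i * n + j))) = of_bool (edge b \<alpha> i j))"
proof -
  let ?s = "den (reconstruct r) s"
  obtain \<alpha> where \<alpha>: "legal_choice \<alpha>" "opt b n 0 = degree_cost (edge b \<alpha>)" "fst ?s Size = int n"
    "fst ?s Out = int (Suc n * n ^ r)"
    "\<And>i j. i < n \<Longrightarrow> j < n \<Longrightarrow> snd ?s (slot i j) = of_bool (j \<in> earlier b \<alpha> i)"
    using reconstruct_correct[of b s] assms(1) unfolding filled_def by blast
  have "snd t (int (Suc (i * n + j))) = of_bool (edge b \<alpha> i j)" if "i < n" "j < n" for i j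
  proof -
    have less: "j < i" if "j \<in> earlier b \<alpha> i" "i < n" for i j
      using \<alpha>(1) that by (auto simp: earlier_def legal_choice_def legal_def)
    have "\<not> (j \<in> earlier b \<alpha> i \<and> i \<in> earlier b \<alpha> j)"
    proof
      assume "j \<in> earlier b \<alpha> i \<and> i \<in> earlier b \<alpha> j"
      then have "j < i" "i < j"
        using less that by blast+
      then show False by simp
    qed
    then show ?thesis
      unfolding t_def print_graph_correct(2)[OF \<alpha>(3,4) that] \<alpha>(5)[OF that] \<alpha>(5)[OF that(2,1)]
      by (auto simp: edge_def)
  qed
  then show ?thesis
    using \<alpha>(1,2) print_graph_correct(1)[OF \<alpha>(3,4)] unfolding t_def by metis
qed

lemma optimize_correct:
  assumes inp: "input (snd s)" and size: "fst s Size = int n" and zero: "\<And>p. p < 0 \<Longrightarrow> snd s p = 0"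
  defines "t \<equiv> den (optimize r) s"
  shows "\<exists>b \<alpha>. legal_choice \<alpha> \<and> degree_cost (edge b \<alpha>) = min (opt False n 0) (opt True n 0) \<and> snd t 0 = int (n * n) \<and>
    (\<forall>i<n. \<forall>j<n. snd t (int (Suc (i * n + j))) = of_bool (edge b \<alpha> i j))"
proof -
  let ?value = "\<lambda>s. snd s (- 1 - (fst s Pos - fst s LayerSize))"
  define s0 where "s0 = set_var Mode 0 (den (powers r) s)"
  define s1 where "s1 = den (fill r) s0"
  define s2 where "s2 = den (fill r) (set_var Mode 1 (set_var Val0 (?value s1) s1))"
  define s3 where "s3 = set_var Val1 (?value s2) s2"
  define s4 where "s4 = den (Cond (Var Val1 [-] Var Val0) (Mode ::= Num 0 ;; fill r) Pass) s3"
  have "Size \<notin> written (powers r)"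
    by (auto simp: powers_def)
  then have "config False s0"
    using powers_correct[OF size] size inp by (simp add: s0_def config_def)
  then have s1: "filled False s1"
    unfolding s1_def by (rule filled_fill) (simp add: s0_def zero slot_negative)
  have s2: "filled True s2"
    unfolding s2_def
    by (rule filled_fill) (use filled_reset(1)[OF s1, of True] s1 in \<open>simp_all add: filled_def\<close>)
  have "fst s3 Val0 = opt False n 0" "fst s3 Val1 = opt True n 0"
    using filled_value[OF s1] filled_value[OF s2] by (simp_all add: s3_def) (simp add: s2_def)
  moreover have "filled False (den (fill r) (set_var Mode 0 s3))"
    by (rule filled_fill) (use filled_reset(2)[OF s2, of False] s2 in \<open>simp_all add: s3_def filled_def\<close>)
  moreover have "filled True s3"
    unfolding s3_def using s2 by (rule filled_reset)
  ultimately have "\<exists>b. filled b s4 \<and> opt b n 0 = min (opt False n 0) (opt True n 0)"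
    by (cases "opt False n 0 < opt True n 0") (auto simp: s4_def)
  moreover have "t = den print_graph (den (reconstruct r) s4)"
    by (simp add: t_def optimize_def s0_def s1_def s2_def s3_def s4_def)
  ultimately show ?thesis
    using filled_optimum by metis
qed

end

section \<open>Encoded instances\<close>

lemma concat_nth_block:
  assumes "i < length xss" "j < length (xss ! i)"
  shows "(\<Sum>k<i. length (xss ! k)) + j < length (concat xss)"
    and "concat xss ! ((\<Sum>k<i. length (xss ! k)) + j) = xss ! i ! j"
proof -
  have "(\<Sum>k<i. length (xss ! k)) + j < length (concat xss) \<and>
    concat xss ! ((\<Sum>k<i. length (xss ! k)) + j) = xss ! i ! j"
    using assms
  proof (induction xss arbitrary: i)
    case (Cons xs xss)
    show ?case
    proof (cases i)
      case 0
      then show ?thesis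
        using Cons.prems by (simp add: nth_append)
    next
      case (Suc i')
      have "(\<Sum>k<i. length ((xs # xss) ! k)) = length xs + (\<Sum>k<i'. length (xss ! k))"
        unfolding Suc by (subst sum.lessThan_Suc_shift) simp
      then show ?thesis
        using Cons.IH[of i'] Cons.prems Suc by (simp add: nth_append add.assoc)
    qed
  qed simp
  then show "(\<Sum>k<i. length (xss ! k)) + j < length (concat xss)"
    "concat xss ! ((\<Sum>k<i. length (xss ! k)) + j) = xss ! i ! j"
    by simp_all
qed

lemma adjacency_length: "length (adjacency n F) = n * n"
proof -
  have "length (concat (map g xs)) = length xs * m" if "\<And>x. length (g x) = m"
    for g :: "nat \<Rightarrow> int list" and xs m
    using that by (induction xs) auto
  then show ?thesis
    unfolding adjacency_def by (simp del: upt_Suc)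
qed

lemma adjacency_nth:
  assumes "i < n" "j < n"
  shows "adjacency n F ! (i * n + j) = of_bool ({Suc i, Suc j} \<in> F)"
proof -
  let ?xss = "map (\<lambda>i. map (\<lambda>j. if {i, j} \<in> F then 1 else 0::int) [1..<Suc n]) [1..<Suc n]"
  have "(\<Sum>k<i. length (?xss ! k)) = (\<Sum>k<i. n)"
    using assms by (intro sum.cong) (auto simp del: upt_Suc)
  then show ?thesis
    using concat_nth_block(2)[of i ?xss j] assms by (simp add: adjacency_def del: upt_Suc)
qed

text \<open>
  The edges at a vertex of a simple graph correspond to the other endpoints.
\<close>

lemma degree_in_eq:
  assumes "simple_graph n F" "i < n"
  shows "degree_in F (Suc i) = card {j. j < n \<and> {Suc i, Suc j} \<in> F}"
proof -
  have "bij_betw (\<lambda>j. {Suc i, Suc j}) {j. j < n \<and> {Suc i, Suc j} \<in> F} {e \<in> F. Suc i \<in> e}"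
    unfolding bij_betw_def
  proof (intro conjI inj_onI equalityI subsetI)
    fix e
    assume e: "e \<in> {e \<in> F. Suc i \<in> e}"
    then obtain j' where "e = {Suc i, j'}" "j' \<in> {1..n}"
      using assms(1) unfolding simple_graph_def card_2_iff by fastforce
    then show "e \<in> (\<lambda>j. {Suc i, Suc j}) ` {j. j < n \<and> {Suc i, Suc j} \<in> F}"
      using e by (intro image_eqI[of _ _ "j' - 1"]) auto
  qed (auto simp: doubleton_eq_iff)
  then show ?thesis
    unfolding degree_in_def by (simp add: bij_betw_same_card)
qed

lemma degree_problem_instance:
  assumes "1 \<le> r" "(n, E, f) \<in> instances r"
  shows "degree_problem n r (\<lambda>i j. {Suc i, Suc j} \<in> E)"
proof
  show "\<not> {Suc i, Suc i} \<in> E" for i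
    using assms(2) by (auto simp: instances_def simple_graph_def)
qed (use assms in \<open>auto simp: instances_def insert_commute\<close>)

lemma input_instance:
  assumes "1 \<le> r" "(n, E, f) \<in> instances r"
  shows "degree_problem.input n (\<lambda>i j. {Suc i, Suc j} \<in> E) (\<lambda>i. f (Suc i))
    (snd (initial (encode_instance (n, E, f))))"
proof -
  interpret degree_problem n r "\<lambda>i j. {Suc i, Suc j} \<in> E" "\<lambda>i. f (Suc i)"
    using assms by (rule degree_problem_instance)
  let ?fs = "map (\<lambda>i. map (f i) [0..<Suc (degree_in E i)]) [1..<Suc n]"
  let ?xs = "encode_instance (n, E, f)"
  have E: "simple_graph n E"
    using assms(2) by (simp add: instances_def)
  have xs: "?xs = int n # adjacency n E @ concat ?fs"
    by (simp add: encode_instance_def)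
  have cell: "snd (initial ?xs) (int (Suc q)) = ?xs ! q" if "q < length ?xs" for q
    using that by (simp add: initial_def)
  have "snd (initial ?xs) (int (2 + i * n + j)) = of_bool ({Suc i, Suc j} \<in> E)" if "i < n" "j < n" for i j
  proof -
    have "i * n + j < (i + 1) * n"
      using that by simp
    also have "\<dots> \<le> n * n"
      using that by (intro mult_le_mono1) simp
    finally have "i * n + j < length (adjacency n E)"
      by (simp add: adjacency_length)
    moreover from this have "?xs ! (Suc (i * n + j)) = adjacency n E ! (i * n + j)" "Suc (i * n + j) < length ?xs"
      by (simp_all add: xs nth_append)
    ultimately show ?thesis
      using cell[of "Suc (i * n + j)"] adjacency_nth[OF that] by simp
  qed
  moreover have "snd (initial ?xs) (int (fun_ptr i + d)) = f (Suc i) d" if "i < n" "d \<le> deg i" for i d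
  proof -
    have deg: "degree_in E (Suc k) = deg k" if "k < n" for k
      using degree_in_eq[OF E that] by (simp add: deg_def)
    have "(\<Sum>k<i. length (?fs ! k)) = (\<Sum>k<i. Suc (deg k))"
      using that by (intro sum.cong) (auto simp: deg simp del: upt_Suc)
    then have pos: "(\<Sum>k<i. length (?fs ! k)) = i + (\<Sum>k<i. deg k)"
      by (simp add: sum_Suc)
    have fs: "?fs ! i ! d = f (Suc i) d" "d < length (?fs ! i)" "i < length ?fs"
      using that by (simp_all add: deg del: upt_Suc)
    let ?q = "i + (\<Sum>k<i. deg k) + d"
    have "concat ?fs ! ?q = f (Suc i) d" "?q < length (concat ?fs)"
      using concat_nth_block[OF fs(3,2)] unfolding pos fs(1) by blast+
    then have "?xs ! (Suc (n * n + ?q)) = f (Suc i) d" "Suc (n * n + ?q) < length ?xs"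
      unfolding xs by (simp_all add: nth_append adjacency_length del: upt_Suc)
    then show ?thesis
      using cell[of "Suc (n * n + ?q)"] by (simp add: fun_ptr_def add.assoc)
  qed
  ultimately show ?thesis
    by (simp add: input_def)
qed

theorem theorem1p4:
  fixes r :: nat
  assumes "r \<ge> 1"
  shows "solvable_in_polynomial_time (instances r) encode_instance
    optimal_subgraph (\<lambda>(n, E, f) F. adjacency n F)"
proof (rule solvable_by_loop_program[where n = fst])
  show "well_formed (optimize r)" "Size \<notin> written (optimize r)"
    by (fact well_formed_optimize, fact Size_unwritten_optimize)
  fix x :: instance_data
  assume x: "x \<in> instances r"
  obtain n E f where nEf: "x = (n, E, f)"
    by (cases x)
  let ?M = "snd (initial (encode_instance x))"
  interpret degree_problem n r "\<lambda>i j. {Suc i, Suc j} \<in> E" "\<lambda>i. f (Suc i)"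
    using assms x unfolding nEf by (rule degree_problem_instance)
  have E: "simple_graph n E" and mono: "(\<forall>i\<in>{r+1..n}. mono_on {0..degree_in E i} (f i)) \<or>
      (\<forall>i\<in>{r+1..n}. antimono_on {0..degree_in E i} (f i))"
    using x by (auto simp: nEf instances_def)
  show "encode_instance x \<noteq> [] \<and> hd (encode_instance x) = int (fst x) \<and> fst x \<le> length (encode_instance x)"
  proof -
    have "n * 1 \<le> n * n"
      using n_pos by (intro mult_le_mono) auto
    then have "n \<le> Suc (n * n + k)" for k
      by linarith
    then show ?thesis
      by (simp add: nEf encode_instance_def adjacency_length)
  qed
  let ?s = "((\<lambda>_. 0)(Size := int (fst x)), ?M)"
  let ?M' = "snd (den (optimize r) ?s)"
  have "input (snd ?s)"
    using input_instance[OF assms, of n E f] x by (simp add: nEf)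
  moreover have "fst ?s Size = int n" "\<And>p. p < 0 \<Longrightarrow> snd ?s p = 0"
    by (simp_all add: nEf initial_def)
  ultimately obtain b \<alpha> where opt: "legal_choice \<alpha>"
    "degree_cost (edge b \<alpha>) = min (opt False n 0) (opt True n 0)" "?M' 0 = int (n * n)"
    "\<And>i j. i < n \<Longrightarrow> j < n \<Longrightarrow> ?M' (int (Suc (i * n + j))) = of_bool (edge b \<alpha> i j)"
    using optimize_correct[of ?s] by blast
  define F where "F = {{Suc i, Suc j} |i j. i < n \<and> j < n \<and> edge b \<alpha> i j}"
  have F_iff: "{Suc i, Suc j} \<in> F \<longleftrightarrow> edge b \<alpha> i j" if "i < n" "j < n" for i j
    using that by (auto simp: F_def doubleton_eq_iff edge_def)
  have F_E: "F \<subseteq> E"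
    using edge_adj[OF opt(1)] by (auto simp: F_def)
  have objective_sum: "(\<Sum>i=1..n. f i (degree_in F' i)) = degree_cost (\<lambda>i j. {Suc i, Suc j} \<in> F')" if "F' \<subseteq> E" for F'
  proof -
    have "simple_graph n F'"
      using E that by (auto simp: simple_graph_def)
    then have "(\<Sum>i<n. f (Suc i) (degree_in F' (Suc i))) = degree_cost (\<lambda>i j. {Suc i, Suc j} \<in> F')"
      unfolding degree_cost_def by (intro sum.cong refl) (simp add: degree_in_eq)
    moreover have "(\<Sum>i=1..n. f i (degree_in F' i)) = (\<Sum>i<n. f (Suc i) (degree_in F' (Suc i)))"
      by (simp add: sum.atLeast1_atMost_eq)
    ultimately show ?thesis by simp
  qed
  have degree_cost_F: "degree_cost (\<lambda>i j. {Suc i, Suc j} \<in> F) = degree_cost (edge b \<alpha>)"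
    unfolding degree_cost_def by (intro sum.cong refl arg_cong[where f = card] arg_cong2[where f = "\<lambda>i. f (Suc i)"]) (auto simp: F_iff)
  have mono': "(\<forall>i\<in>{r..<n}. mono_on {0..deg i} (f (Suc i))) \<or> (\<forall>i\<in>{r..<n}. antimono_on {0..deg i} (f (Suc i)))"
  proof -
    have "degree_in E (Suc i) = deg i" "Suc i \<in> {r+1..n}" if "i \<in> {r..<n}" for i
      using degree_in_eq[OF E, of i] that by (auto simp: deg_def)
    then show ?thesis
      using mono by metis
  qed
  have "degree_cost (edge b \<alpha>) \<le> degree_cost (\<lambda>i j. {Suc i, Suc j} \<in> F')" if "F' \<subseteq> E" for F'
    unfolding opt(2) using mono' that by (intro opt_le_any) (auto simp: insert_commute)
  then have "optimal_subgraph x F"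
    using F_E objective_sum degree_cost_F
    by (auto simp: optimal_subgraph_def nEf is_arg_min_def not_less)
  moreover have "result (\<lambda>_. 0, ?M') = adjacency n F"
  proof (rule nth_equalityI)
    show len: "length (result (\<lambda>_. 0, ?M')) = length (adjacency n F)"
      unfolding result_def adjacency_length snd_conv opt(3) by (simp add: nat_mult_distrib)
    fix q
    assume "q < length (result (\<lambda>_. 0, ?M'))"
    then have q: "q < n * n"
      by (simp only: len adjacency_length)
    then have ij: "q div n < n" "q mod n < n" "q = (q div n) * n + q mod n"
      using n_pos by (simp_all add: less_mult_imp_div_less)
    have "int (Suc q) \<le> int (n * n)"
      using q by (simp only: of_nat_le_iff Suc_le_eq)
    then have "[1..int (n * n)] ! q = int (Suc q)"
      using nth_upto[of 1 q "int (n * n)"] by simp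
    moreover have "q < length [1..int (n * n)]"
      using q by (simp add: nat_mult_distrib)
    ultimately have "result (\<lambda>_. 0, ?M') ! q = ?M' (int (Suc q))"
      unfolding result_def snd_conv opt(3) by (simp only: nth_map)
    also have "\<dots> = of_bool (edge b \<alpha> (q div n) (q mod n))"
      using opt(4)[OF ij(1,2)] ij(3) by simp
    also have "\<dots> = adjacency n F ! q"
      using adjacency_nth[OF ij(1,2), of F] ij(3) F_iff[OF ij(1,2)] by simp
    finally show "result (\<lambda>_. 0, ?M') ! q = adjacency n F ! q" .
  qed
  ultimately show "\<exists>y. optimal_subgraph x y \<and>
      result (\<lambda>_. 0, ?M') = (case x of (n, E, f) \<Rightarrow> \<lambda>F. adjacency n F) y"
    by (auto simp: nEf)
qed

end
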